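(* Let $\varphi:\mathbb{C}\to\mathbb{C}$ be any function. Then: 1. $S_\varphi:\mathcal{H}^\infty_+\to\mathcal{H}^\infty_+$ is well defined if and only if $\varphi$ is entire; 2. if $S_\varphi:\mathcal{H}_+\to\mathcal{H}_+$ is well defined, then $\varphi$ is entire.
   Context: For $\sigma\in\mathbb{R}$, $\mathbb{C}_\sigma=\{s\in\mathbb{C}:\operatorname{Re}s>\sigma\}$ and $\mathbb{C}_+=\mathbb{C}_0$. $\mathcal{H}^\infty$ is the space of Dirichlet series that define a bounded holomorphic function on $\mathbb{C}_+$; $\mathcal{H}^\infty_+$ is the space of Dirichlet series $\sum a_nn^{-s}$ such that $\sum\frac{a_n}{n^\sigma}n^{-s}\in\mathcal{H}^\infty$ for every $\sigma>0$ (such series converge on $\mathbb{C}_+$). $\mathcal{H}_{+}$ is the space of Dirichlet series $D=\sum a_nn^{-s}$ with $\sum_n|a_n|^2n^{-2\sigma}<\infty$ for every $\sigma>0$ (such series converge absolutely on $\mathbb{C}_{\frac12}$). The superposition operator with symbol $\varphi$ is $S_\varphi(D)=\varphi\circ D$; $S_\varphi:E\to E$ is well defined if for every $D\in E$ the function $\varphi\circ D$ (defined on $\mathbb{C}_+$ if $E=\mathcal{H}^\infty_+$, on $\mathbb{C}_{\frac12}$ if $E=\mathcal{H}_+$) is given there by a Dirichlet series belonging to $E$. *)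

theory Defs
  imports "HOL-Analysis.Analysis"
begin

text \<open>
  A Dirichlet series \<open>\<Sum>\<^sub>n\<^sub>\<ge>\<^sub>1 a\<^sub>n n\<^sup>-\<^sup>s\<close> is represented by its coefficients \<open>a\<close>. The value \<open>a 0\<close>
  is never used: all sums below run over \<open>Suc n\<close>.
\<close>

type_synonym dirichlet_series = "nat \<Rightarrow> complex"

definition halfplane :: "real \<Rightarrow> complex set" where
  "halfplane \<sigma> = {s. Re s > \<sigma>}"

definition dirichlet_term :: "dirichlet_series \<Rightarrow> complex \<Rightarrow> nat \<Rightarrow> complex" where
  "dirichlet_term a s n = a (Suc n) * of_nat (Suc n) powr (- s)"

definition dirichlet_sum :: "dirichlet_series \<Rightarrow> complex \<Rightarrow> complex" where
  "dirichlet_sum a s = (\<Sum>n. dirichlet_term a s n)"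

definition H_infty :: "dirichlet_series set" where
  "H_infty = {a. (\<forall>s \<in> halfplane 0. summable (dirichlet_term a s))
               \<and> dirichlet_sum a holomorphic_on halfplane 0
               \<and> bounded (dirichlet_sum a ` halfplane 0)}"

definition H_infty_plus :: "dirichlet_series set" where
  "H_infty_plus = {a. \<forall>\<sigma>::real. \<sigma> > 0 \<longrightarrow> (\<lambda>n. a n / of_real (real n powr \<sigma>)) \<in> H_infty}"

definition H_plus :: "dirichlet_series set" where
  "H_plus = {a. \<forall>\<sigma>::real. \<sigma> > 0 \<longrightarrow>
       summable (\<lambda>n. (cmod (a (Suc n)))\<^sup>2 * real (Suc n) powr (- 2 * \<sigma>))}"

definition superposition :: "(complex \<Rightarrow> complex) \<Rightarrow> (complex \<Rightarrow> complex) \<Rightarrow> complex \<Rightarrow> complex" where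
  "superposition \<phi> F = \<phi> \<circ> F"

text \<open>
  \<open>\<Omega>\<close> is a domain on which every series of \<open>E\<close> converges; the composition is only
  considered there.
\<close>

definition superposition_well_defined ::
    "(complex \<Rightarrow> complex) \<Rightarrow> dirichlet_series set \<Rightarrow> complex set \<Rightarrow> bool" where
  "superposition_well_defined \<phi> E \<Omega> \<longleftrightarrow>
     (\<forall>a \<in> E. \<exists>b \<in> E. \<forall>s \<in> \<Omega>.
        dirichlet_term b s sums superposition \<phi> (dirichlet_sum a) s)"

end

theory Submission
  imports Defs "HOL-Complex_Analysis.Complex_Analysis" "HOL-Probability.Sinc_Integral"
begin

text \<open>
  If composition with \<open>\<phi>\<close> preserves Dirichlet series, apply it to \<open>D(s) = z - 1 + 2 \<cdot> 2\<^sup>-\<^sup>s\<close>: near \<open>z\<close> the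
  function \<open>\<phi>\<close> is the holomorphic function \<open>\<phi> \<circ> D\<close> composed with a holomorphic local inverse of \<open>D\<close>.

  Conversely let \<open>\<phi>\<close> be entire. Far to the right \<open>D\<close> converges absolutely, and expanding \<open>\<phi>\<close> in its
  power series shows that \<open>f = \<phi> \<circ> D\<close> is an absolutely convergent Dirichlet series \<open>\<Sum> b\<^sub>n n\<^sup>-\<^sup>s\<close> there.
  On every half-plane \<open>Re s > \<sigma> > 0\<close> the function \<open>f\<close> is bounded, and Bohr's theorem carries the
  convergence over to all of \<open>Re s > 0\<close>. For Bohr's theorem, take an integrable kernel whose Fourier
  transform is a trapezoid equal to 1 on \<open>[- ln N, ln N]\<close> and to 0 outside \<open>[- ln (N+1), ln (N+1)]\<close>.
  Convolving \<open>f\<close> with it along vertical lines gives exactly the partial sum \<open>\<Sum>\<^sub>n\<^sub>\<le>\<^sub>N b\<^sub>n n\<^sup>-\<^sup>s\<close>, far to the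
  right by absolute convergence and then on \<open>Re s > 0\<close> by the identity theorem. The \<open>L\<^sup>1\<close> norm of the
  kernel is \<open>O(N\<^sup>\<epsilon>)\<close>, hence so are the partial sums, and summation by parts gives convergence.
\<close>

section \<open>Absolutely convergent Dirichlet series\<close>

lemma norm_nat_powr: "cmod (of_nat (Suc n) powr s) = real (Suc n) powr Re s"
  by (subst norm_powr_real_powr) auto

lemma norm_dirichlet_term:
  "cmod (dirichlet_term a s n) = cmod (a (Suc n)) * real (Suc n) powr - Re s"
  by (simp only: dirichlet_term_def norm_mult norm_nat_powr uminus_complex.simps)

lemma norm_dirichlet_term_mono:
  assumes "Re s \<le> Re t"
  shows "cmod (dirichlet_term a t n) \<le> cmod (dirichlet_term a s n)"
  unfolding norm_dirichlet_term using assms by (intro mult_left_mono powr_mono) auto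

lemma dirichlet_term_shift:
  "dirichlet_term (\<lambda>n. a n / of_real (real n powr \<sigma>)) s n = dirichlet_term a (s + of_real \<sigma>) n"
proof -
  have "complex_of_real (real (Suc n) powr \<sigma>) = of_nat (Suc n) powr of_real \<sigma>"
    by (subst powr_of_real[symmetric]) auto
  moreover have "(of_nat (Suc n) :: complex) powr (- (s + of_real \<sigma>))
      = of_nat (Suc n) powr (- s) / of_nat (Suc n) powr of_real \<sigma>"
    by (simp only: minus_add_distrib powr_add powr_minus divide_inverse)
  ultimately show ?thesis
    by (simp only: dirichlet_term_def times_divide_eq_left times_divide_eq_right)
qed

text \<open>\<open>C\<close> plays the role of a norm bound: it multiplies under products and adds
  under sums. An inequality \<open>c \<le> C\<close> is used because collecting equal frequencies
  can only decrease the sum of the norms. Unconditional \<open>has_sum\<close> makes rearrangement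
  free.\<close>

definition abs_dirichlet :: "real \<Rightarrow> real \<Rightarrow> (complex \<Rightarrow> complex) \<Rightarrow> bool" where
  "abs_dirichlet \<sigma> C F \<longleftrightarrow> (\<exists>a. (\<exists>c\<le>C. ((\<lambda>n. cmod (dirichlet_term a (of_real \<sigma>) n)) has_sum c) UNIV)
     \<and> (\<forall>s. \<sigma> \<le> Re s \<longrightarrow> (dirichlet_term a s has_sum F s) UNIV))"

text \<open>Sums and products of Dirichlet series first appear as families over some index type in
  which a frequency can occur repeatedly. Absolute summability allows collecting the terms of equal
  frequency, and the triangle inequality on each fibre of \<open>\<nu>\<close> keeps the norm
  bound.\<close>

lemma abs_dirichlet_regroup:
  fixes x :: "'i \<Rightarrow> complex" and \<nu> :: "'i \<Rightarrow> nat"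
  assumes norm_sum: "((\<lambda>i. cmod (x i) * real (Suc (\<nu> i)) powr - \<sigma>) has_sum c) UNIV" and "c \<le> C"
    and F: "\<And>s. \<sigma> \<le> Re s \<Longrightarrow> ((\<lambda>i. x i * of_nat (Suc (\<nu> i)) powr - s) has_sum F s) UNIV"
  shows "abs_dirichlet \<sigma> C F"
proof -
  define a where "a n = infsum x {i. Suc (\<nu> i) = n}" for n
  \<comment> \<open>Every index lies in exactly one fibre, so a sum over \<open>i\<close> becomes an
    iterated sum over \<open>n\<close> and the fibre of \<open>n\<close>. The weight depends only on
    \<open>n\<close> and can be cancelled inside the fibre.\<close>
  have bij: "bij_betw snd (SIGMA n:UNIV. {i. Suc (\<nu> i) = Suc n}) (UNIV :: 'i set)"
    by (rule bij_betwI[where g = "\<lambda>i. (\<nu> i, i)"]) auto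
  have norm_sum': "((\<lambda>(n, i). cmod (x i) * real (Suc n) powr - \<sigma>) has_sum c)
      (SIGMA n:UNIV. {i. Suc (\<nu> i) = Suc n})"
    using norm_sum unfolding has_sum_reindex_bij_betw[OF bij, symmetric]
    by (rule iffD1[OF has_sum_cong, rotated]) auto
  have fibre: "(\<lambda>i. cmod (x i)) summable_on {i. Suc (\<nu> i) = Suc n}" for n
  proof -
    have "(\<lambda>i. cmod (x i) * real (Suc n) powr - \<sigma>) summable_on {i. Suc (\<nu> i) = Suc n}"
      using summable_on_SigmaD1[OF has_sum_imp_summable[OF norm_sum'], of n] by simp
    from summable_on_cmult_left[OF this, of "real (Suc n) powr \<sigma>"]
    show ?thesis by (simp add: mult.assoc powr_add[symmetric] powr_minus)
  qed
  have fibre_x: "(x has_sum a (Suc n)) {i. Suc (\<nu> i) = Suc n}" for n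
    unfolding a_def using abs_summable_summable[OF fibre] by (rule has_sum_infsum)
  define N where "N n = infsum (\<lambda>i. cmod (x i)) {i. Suc (\<nu> i) = Suc n}" for n
  have N: "((\<lambda>i. cmod (x i)) has_sum N n) {i. Suc (\<nu> i) = Suc n}" for n
    unfolding N_def using fibre by (rule has_sum_infsum)
  have "((\<lambda>n. N n * real (Suc n) powr - \<sigma>) has_sum c) UNIV"
    using norm_sum' by (rule has_sum_SigmaD) (simp only: prod.case, rule has_sum_cmult_left[OF N])
  moreover have bound: "cmod (dirichlet_term a (of_real \<sigma>) n) \<le> N n * real (Suc n) powr - \<sigma>" for n
    unfolding norm_dirichlet_term using norm_has_sum_bound[OF N fibre_x]
    by (auto intro!: mult_right_mono)
  ultimately have summ: "(\<lambda>n. cmod (dirichlet_term a (of_real \<sigma>) n)) summable_on UNIV"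
    by (blast intro: Infinite_Sum.abs_summable_on_comparison_test' has_sum_imp_summable)
  moreover have "infsum (\<lambda>n. cmod (dirichlet_term a (of_real \<sigma>) n)) UNIV \<le> c"
    using has_sum_mono[OF has_sum_infsum[OF summ] \<open>((\<lambda>n. N n * _) has_sum c) UNIV\<close>] bound by blast
  moreover have "(dirichlet_term a s has_sum F s) UNIV" if s: "\<sigma> \<le> Re s" for s
  proof -
    have "((\<lambda>(n, i). x i * of_nat (Suc n) powr - s) has_sum F s)
      (SIGMA n:UNIV. {i. Suc (\<nu> i) = Suc n})"
      using F[OF s] unfolding has_sum_reindex_bij_betw[OF bij, symmetric]
      by (rule iffD1[OF has_sum_cong, rotated]) (auto simp del: of_nat_Suc)
    thus ?thesis unfolding dirichlet_term_def
      by (rule has_sum_SigmaD) (simp only: prod.case, rule has_sum_cmult_left[OF fibre_x])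
  qed
  ultimately show ?thesis
    unfolding abs_dirichlet_def using \<open>c \<le> C\<close> has_sum_infsum[OF summ] by (intro exI[of _ a]) (meson order_trans)
qed

section \<open>Products, powers, infinite sums and composition with entire functions\<close>

lemma has_sum_product_of_abs_summable:
  fixes f g :: "nat \<Rightarrow> complex"
  assumes "((\<lambda>n. cmod (f n)) has_sum c) UNIV" "((\<lambda>n. cmod (g n)) has_sum d) UNIV"
    and "(f has_sum x) UNIV" "(g has_sum y) UNIV"
  shows "((\<lambda>(m, n). cmod (f m * g n)) has_sum (c * d)) UNIV"
    and "((\<lambda>(m, n). f m * g n) has_sum (x * y)) UNIV"
proof -
  have inner: "((\<lambda>n. cmod (f m * g n)) has_sum (cmod (f m) * d)) UNIV" for m
    unfolding norm_mult by (intro has_sum_cmult_right assms)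
  have outer: "((\<lambda>m. cmod (f m) * d) has_sum (c * d)) UNIV"
    by (intro has_sum_cmult_left assms)
  have "(\<lambda>(m, n). cmod (f m * g n)) summable_on (UNIV \<times> UNIV)"
    by (rule summable_on_SigmaI[where g = "\<lambda>m. cmod (f m) * d"])
      (use inner outer has_sum_imp_summable in auto)
  moreover from this have "(\<lambda>(m, n). f m * g n) summable_on (UNIV \<times> UNIV)"
    unfolding case_prod_beta' by (rule abs_summable_summable)
  ultimately have "((\<lambda>(m, n). cmod (f m * g n)) has_sum (c * d)) (UNIV \<times> UNIV)"
    and "((\<lambda>(m, n). f m * g n) has_sum (x * y)) (UNIV \<times> UNIV)"
    using has_sum_SigmaI[where f = "\<lambda>(m, n). cmod (f m * g n)" and B = "\<lambda>_. UNIV", OF _ outer]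
      has_sum_SigmaI[where f = "\<lambda>(m, n). f m * g n" and B = "\<lambda>_. UNIV", OF _ has_sum_cmult_left[OF assms(3)]]
      inner has_sum_cmult_right[OF assms(4)]
    unfolding prod.case by blast+
  thus "((\<lambda>(m, n). cmod (f m * g n)) has_sum (c * d)) UNIV"
    "((\<lambda>(m, n). f m * g n) has_sum (x * y)) UNIV"
    by simp_all
qed

lemma abs_dirichlet_mult:
  assumes "abs_dirichlet \<sigma> C F" "abs_dirichlet \<sigma> D G"
  shows "abs_dirichlet \<sigma> (C * D) (\<lambda>s. F s * G s)"
proof -
  obtain a c where a: "c \<le> C" "((\<lambda>n. cmod (dirichlet_term a (of_real \<sigma>) n)) has_sum c) UNIV"
    "\<And>s. \<sigma> \<le> Re s \<Longrightarrow> (dirichlet_term a s has_sum F s) UNIV"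
    using assms(1) by (auto simp: abs_dirichlet_def)
  obtain b d where b: "d \<le> D" "((\<lambda>n. cmod (dirichlet_term b (of_real \<sigma>) n)) has_sum d) UNIV"
    "\<And>s. \<sigma> \<le> Re s \<Longrightarrow> (dirichlet_term b s has_sum G s) UNIV"
    using assms(2) by (auto simp: abs_dirichlet_def)
  define x where "x = (\<lambda>(m, n). a (Suc m) * b (Suc n))"
  \<comment> \<open>Positions \<open>m\<close> and \<open>n\<close> stand for the integers m+1 and
    n+1, so their product sits at position (m+1)(n+1)-1. Regrouping along \<open>\<nu>\<close> is
    Dirichlet convolution.\<close>
  define \<nu> where "\<nu> = (\<lambda>(m, n). Suc m * Suc n - 1)"
  have x: "x i * of_nat (Suc (\<nu> i)) powr - s = (case i of (m, n) \<Rightarrow> dirichlet_term a s m * dirichlet_term b s n)"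
    for s i
  proof (cases i)
    case (Pair m n)
    have "of_nat (Suc (\<nu> (m, n))) = complex_of_real (Suc m) * complex_of_real (Suc n)"
      by (simp add: \<nu>_def algebra_simps)
    hence "of_nat (Suc (\<nu> (m, n))) powr - s = of_nat (Suc m) powr - s * of_nat (Suc n) powr - s"
      by (simp only: powr_times_real_left of_nat_0_le_iff of_real_of_nat_eq) (simp add: powr_times_real)
    thus ?thesis by (simp add: Pair x_def dirichlet_term_def)
  qed
  have nx: "cmod (x i) * real (Suc (\<nu> i)) powr - \<sigma>
      = (case i of (m, n) \<Rightarrow> cmod (dirichlet_term a (of_real \<sigma>) m * dirichlet_term b (of_real \<sigma>) n))" for i
    using arg_cong[OF x[of i "of_real \<sigma>"], of cmod] by (simp add: norm_mult norm_nat_powr case_prod_beta' del: of_nat_Suc)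
  have "0 \<le> c" "0 \<le> d" using a(2) b(2) by (auto intro: has_sum_nonneg)
  note prod = has_sum_product_of_abs_summable
  show ?thesis
  proof (rule abs_dirichlet_regroup)
    show "((\<lambda>i. cmod (x i) * real (Suc (\<nu> i)) powr - \<sigma>) has_sum (c * d)) UNIV"
      unfolding nx using prod(1)[OF a(2) b(2) a(3) b(3)] by simp
    show "c * d \<le> C * D" using \<open>c \<le> C\<close> \<open>d \<le> D\<close> \<open>0 \<le> c\<close> \<open>0 \<le> d\<close> by (intro mult_mono) auto
    show "((\<lambda>i. x i * of_nat (Suc (\<nu> i)) powr - s) has_sum F s * G s) UNIV" if "\<sigma> \<le> Re s" for s
    proof -
      have "(\<lambda>n. cmod (dirichlet_term a s n)) summable_on UNIV"
        by (rule Infinite_Sum.abs_summable_on_comparison_test'[OF has_sum_imp_summable[OF a(2)]])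
          (rule norm_dirichlet_term_mono, use that in simp)
      moreover have "(\<lambda>n. cmod (dirichlet_term b s n)) summable_on UNIV"
        by (rule Infinite_Sum.abs_summable_on_comparison_test'[OF has_sum_imp_summable[OF b(2)]])
          (rule norm_dirichlet_term_mono, use that in simp)
      ultimately
      show ?thesis unfolding x
        using prod(2)[OF has_sum_infsum has_sum_infsum a(3) b(3), OF _ _ that that] by blast
    qed
  qed
qed

lemma abs_dirichlet_one: "abs_dirichlet \<sigma> 1 (\<lambda>_. 1)"
  by (rule abs_dirichlet_regroup[where x = "\<lambda>_::unit. 1" and \<nu> = "\<lambda>_. 0" and c = 1])
    (auto simp: has_sum_finite_iff)

lemma abs_dirichlet_cmult:
  assumes "abs_dirichlet \<sigma> C F"
  shows "abs_dirichlet \<sigma> (cmod k * C) (\<lambda>s. k * F s)"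
proof -
  have "abs_dirichlet \<sigma> (cmod k) (\<lambda>_. k)"
    by (rule abs_dirichlet_regroup[where x = "\<lambda>_::unit. k" and \<nu> = "\<lambda>_. 0" and c = "cmod k"])
      (auto simp: has_sum_finite_iff)
  thus ?thesis using assms by (rule abs_dirichlet_mult)
qed

lemma abs_dirichlet_power:
  assumes "abs_dirichlet \<sigma> C F"
  shows "abs_dirichlet \<sigma> (C ^ k) (\<lambda>s. F s ^ k)"
  by (induction k) (auto simp: abs_dirichlet_one intro: abs_dirichlet_mult assms)

text \<open>Completeness of the algebra: the family over pairs \<open>(k, n)\<close> is absolutely
  summable with total at most \<open>suminf C\<close>, so it may be regrouped by \<open>n\<close>
  instead of being summed over \<open>n\<close> first.\<close>

lemma abs_dirichlet_suminf:
  fixes F :: "nat \<Rightarrow> complex \<Rightarrow> complex"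
  assumes "\<And>k. abs_dirichlet \<sigma> (C k) (F k)" "summable C"
  shows "abs_dirichlet \<sigma> (suminf C) (\<lambda>s. \<Sum>k. F k s)"
proof -
  have "\<forall>k. \<exists>a c. c \<le> C k \<and> ((\<lambda>n. cmod (dirichlet_term a (of_real \<sigma>) n)) has_sum c) UNIV
      \<and> (\<forall>s. \<sigma> \<le> Re s \<longrightarrow> (dirichlet_term a s has_sum F k s) UNIV)"
    using assms(1) unfolding abs_dirichlet_def by blast
  then obtain a c where a: "\<And>k. c k \<le> C k"
    "\<And>k. ((\<lambda>n. cmod (dirichlet_term (a k) (of_real \<sigma>) n)) has_sum c k) UNIV"
    "\<And>k s. \<sigma> \<le> Re s \<Longrightarrow> (dirichlet_term (a k) s has_sum F k s) UNIV"
    by metis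
  define x where "x = (\<lambda>(k, n). a k (Suc n))"
  have x: "x i * of_nat (Suc (snd i)) powr - s = (case i of (k, n) \<Rightarrow> dirichlet_term (a k) s n)" for s i
    by (simp add: x_def dirichlet_term_def case_prod_beta')
  have nx: "cmod (x i) * real (Suc (snd i)) powr - \<sigma>
      = (case i of (k, n) \<Rightarrow> cmod (dirichlet_term (a k) (of_real \<sigma>) n))" for i
    unfolding x_def norm_dirichlet_term by (simp add: case_prod_beta')
  have c0: "0 \<le> c k" for k using a(2)[of k] by (auto intro: has_sum_nonneg)
  have summ_c: "summable c"
    by (rule summable_comparison_test'[OF assms(2), of 0]) (use c0 a(1) in auto)
  hence hc: "(c has_sum suminf c) UNIV"
    using c0 by (intro norm_summable_imp_has_sum) auto
  have s1: "(\<lambda>(k, n). cmod (dirichlet_term (a k) (of_real \<sigma>) n)) summable_on UNIV \<times> UNIV"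
    by (rule summable_on_SigmaI[where g = c]) (use a(2) hc has_sum_imp_summable in auto)
  have h1: "((\<lambda>(k, n). cmod (dirichlet_term (a k) (of_real \<sigma>) n)) has_sum suminf c) (UNIV \<times> UNIV)"
    by (rule has_sum_SigmaI[where g = c]) (use a(2) hc s1 in auto)
  show ?thesis
  proof (rule abs_dirichlet_regroup)
    show "((\<lambda>i. cmod (x i) * real (Suc (snd i)) powr - \<sigma>) has_sum (suminf c)) UNIV"
      using h1 unfolding nx by simp
    show "suminf c \<le> suminf C" by (intro suminf_le a(1) summ_c assms(2))
    show "((\<lambda>i. x i * of_nat (Suc (snd i)) powr - s) has_sum (\<Sum>k. F k s)) UNIV" if s: "\<sigma> \<le> Re s" for s
    proof -
      have "cmod (case i of (k, n) \<Rightarrow> dirichlet_term (a k) s n)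
          \<le> (case i of (k, n) \<Rightarrow> cmod (dirichlet_term (a k) (of_real \<sigma>) n))" for i
        unfolding case_prod_beta' by (rule norm_dirichlet_term_mono) (use s in simp)
      from Infinite_Sum.abs_summable_on_comparison_test'[OF s1 this]
      have "(\<lambda>i. norm (case i of (k, n) \<Rightarrow> dirichlet_term (a k) s n)) summable_on UNIV \<times> UNIV" .
      hence "(\<lambda>(k, n). dirichlet_term (a k) s n) summable_on UNIV \<times> UNIV"
        by (rule abs_summable_summable)
      then obtain S where S: "((\<lambda>(k, n). dirichlet_term (a k) s n) has_sum S) (UNIV \<times> UNIV)"
        by (auto simp: summable_on_def)
      hence "((\<lambda>k. F k s) has_sum S) UNIV"
        by (rule has_sum_SigmaD) (use a(3)[OF s] in auto)
      hence "S = (\<Sum>k. F k s)" by (auto dest!: has_sum_imp_sums simp: sums_iff)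
      thus ?thesis using S unfolding x by simp
    qed
  qed
qed

text \<open>Functional calculus: the k-th term of the Taylor series of \<open>\<phi>\<close>,
  evaluated at \<open>F\<close>, has norm at most \<open>cmod (p k) * C ^ k\<close>, and these
  bounds are summable because the Taylor series converges everywhere.\<close>

lemma abs_dirichlet_entire_comp:
  assumes "abs_dirichlet \<sigma> C F" and \<phi>: "\<phi> holomorphic_on UNIV"
  shows "\<exists>C'. abs_dirichlet \<sigma> C' (\<lambda>s. \<phi> (F s))"
proof -
  define p where "p k = (deriv ^^ k) \<phi> 0 / fact k" for k
  have p: "(\<lambda>k. p k * z ^ k) sums \<phi> z" for z
    using holomorphic_power_series[of \<phi> 0 "norm z + 1" z] \<phi> holomorphic_on_subset
    by (auto simp: p_def)
  obtain a c where "c \<le> C" "((\<lambda>n. cmod (dirichlet_term a (of_real \<sigma>) n)) has_sum c) UNIV"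
    using assms(1) unfolding abs_dirichlet_def by blast
  hence C: "0 \<le> C" by (meson has_sum_nonneg norm_ge_zero order_trans)
  \<comment> \<open>Convergence at \<open>C + 1\<close> gives absolute convergence at
    \<open>C\<close>, which is strictly closer to 0.\<close>
  have "summable (\<lambda>k. cmod (p k * of_real C ^ k))"
    by (rule powser_insidea[OF sums_summable[OF p[of "of_real (C + 1)"]]]) (use C in \<open>simp del: of_real_add\<close>)
  hence "summable (\<lambda>k. cmod (p k) * C ^ k)"
    using C by (simp add: norm_mult norm_power)
  from abs_dirichlet_suminf[OF _ this, where F = "\<lambda>k s. p k * F s ^ k" and \<sigma> = \<sigma>]
  have "abs_dirichlet \<sigma> (\<Sum>k. cmod (p k) * C ^ k) (\<lambda>s. \<Sum>k. p k * F s ^ k)"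
    by (simp add: abs_dirichlet_cmult abs_dirichlet_power assms(1))
  moreover have "(\<Sum>k. p k * F s ^ k) = \<phi> (F s)" for s
    using p by (simp add: sums_iff)
  ultimately show ?thesis by auto
qed

section \<open>A kernel with trapezoidal Fourier transform\<close>

text \<open>An integrable majorant for all the kernels below. It does not involve their parameters,
  which enter only through a constant factor.\<close>

definition decay :: "real \<Rightarrow> real \<Rightarrow> real" where
  "decay \<epsilon> t = (if \<bar>t\<bar> \<le> 1 then \<bar>t\<bar> powr (\<epsilon> - 1) else \<bar>t\<bar> powr (- 1 - \<epsilon>))"

lemma decay_nonneg: "0 \<le> decay \<epsilon> t"
  by (simp add: decay_def)

lemma decay_measurable [measurable]: "decay \<epsilon> \<in> borel_measurable borel"
  unfolding decay_def by measurable

lemma integrable_decay: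
  assumes "0 < \<epsilon>"
  shows "integrable lborel (decay \<epsilon>)"
proof -
  have near: "set_integrable lborel {0<..1} (\<lambda>t. t powr (\<epsilon> - 1))"
  proof -
    have "(\<lambda>t. t powr (\<epsilon> - 1)) absolutely_integrable_on {0<..1}"
      using assms by (intro nonnegative_absolutely_integrable_1 integrable_on_powr_from_0') auto
    thus ?thesis unfolding set_integrable_def
      by (subst (asm) integrable_completion) measurable
  qed
  have far: "set_integrable lborel {1<..} (\<lambda>t. t powr (- 1 - \<epsilon>))"
  proof -
    have "(\<lambda>t. t powr (- 1 - \<epsilon>)) absolutely_integrable_on {1..}"
      using assms has_integral_powr_to_inf[of "- 1 - \<epsilon>" 1]
      by (intro nonnegative_absolutely_integrable_1) (auto simp: integrable_on_def)
    hence "set_integrable lborel {1..} (\<lambda>t. t powr (- 1 - \<epsilon>))" unfolding set_integrable_def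
      by (subst (asm) integrable_completion) measurable
    thus ?thesis by (rule set_integrable_subset) auto
  qed
  \<comment> \<open>\<open>g\<close> is the part of \<open>decay\<close> on the positive axis, and
    \<open>decay\<close> is even. At the origin both sides of the later identity vanish, since
    \<open>0 powr x\<close> is 0.\<close>
  define g where "g t = indicat_real {0<..1} t *\<^sub>R t powr (\<epsilon> - 1) + indicat_real {1<..} t *\<^sub>R t powr (- 1 - \<epsilon>)" for t
  have g: "integrable lborel g"
    using near far unfolding set_integrable_def g_def by (rule Bochner_Integration.integrable_add)
  hence "integrable lborel (\<lambda>t. g t + g (- t))"
    using lborel_integrable_real_affine[OF g, of "-1" 0] by simp
  moreover have "decay \<epsilon> t = g t + g (- t)" for t
    by (auto simp: g_def decay_def indicator_def)
  ultimately show ?thesis by presburger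
qed

text \<open>Interpolation between the bounds 1 and \<open>1 / \<bar>x\<bar>\<close>. The free
  exponent makes it possible to distribute the decay in \<open>t\<close> over the two factors of the
  kernel.\<close>

lemma abs_sinc_le:
  assumes "0 \<le> \<theta>" "\<theta> \<le> 1" "x \<noteq> 0"
  shows "\<bar>sinc x\<bar> \<le> \<bar>x\<bar> powr - \<theta>"
proof -
  have "\<bar>sin x\<bar> \<le> \<bar>x\<bar> powr (1 - \<theta>)"
  proof (cases "\<bar>x\<bar> \<le> 1")
    case True
    have "\<bar>sin x\<bar> \<le> \<bar>x\<bar>" by (rule abs_sin_x_le_abs_x)
    also have "\<dots> \<le> \<bar>x\<bar> powr (1 - \<theta>)"
      using powr_mono'[of "1 - \<theta>" 1 "\<bar>x\<bar>"] True assms by simp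
    finally show ?thesis .
  next
    case False
    thus ?thesis using ge_one_powr_ge_zero[of "\<bar>x\<bar>" "1 - \<theta>"] assms abs_sin_le_one[of x] by linarith
  qed
  hence "\<bar>sin x\<bar> / \<bar>x\<bar> \<le> \<bar>x\<bar> powr (1 - \<theta>) / \<bar>x\<bar>" by (rule divide_right_mono) simp
  also have "\<dots> = \<bar>x\<bar> powr - \<theta>" using assms by (simp add: powr_diff powr_minus field_simps)
  finally show ?thesis using assms by (simp add: abs_divide)
qed

text \<open>
  Up to the factor \<open>fejer_mass\<close>, the Fourier transform is the trapezoid that is 1 on \<open>[-(p-q), p-q]\<close>
  and 0 outside \<open>[-(p+q), p+q]\<close>.
\<close>

definition trapezoid_kernel :: "real \<Rightarrow> real \<Rightarrow> real \<Rightarrow> real" where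
  "trapezoid_kernel p q t = p * sinc (p * t) * sinc (q * t)"

lemma trapezoid_kernel_measurable [measurable]: "trapezoid_kernel p q \<in> borel_measurable borel"
  unfolding trapezoid_kernel_def by measurable

lemma continuous_on_trapezoid_kernel: "continuous_on S (trapezoid_kernel p q)"
  unfolding trapezoid_kernel_def by (intro continuous_intros)

lemma trapezoid_kernel_eq:
  "t \<noteq> 0 \<Longrightarrow> p \<noteq> 0 \<Longrightarrow> q \<noteq> 0 \<Longrightarrow> trapezoid_kernel p q t = sin (p * t) * sin (q * t) / (q * t\<^sup>2)"
  by (simp add: trapezoid_kernel_def power2_eq_square)

lemma trapezoid_kernel_even: "trapezoid_kernel p q (- t) = trapezoid_kernel p q t"
  using sinc_neg[of "p * t"] sinc_neg[of "q * t"] by (simp add: trapezoid_kernel_def)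

text \<open>Near 0 the first \<open>sinc\<close> is estimated with exponent
  \<open>1 - \<epsilon>\<close> and the second by 1, which leaves \<open>p powr \<epsilon>\<close>.
  Far out the exponents are 1 and \<open>\<epsilon>\<close>, which leaves
  \<open>q powr - \<epsilon>\<close>. With \<open>q\<close> of order 1/N this produces only a factor
  of order N to the power \<open>\<epsilon>\<close>.\<close>

lemma abs_trapezoid_kernel_le:
  assumes "0 < \<epsilon>" "\<epsilon> \<le> 1" "0 < p" "0 < q" "t \<noteq> 0"
  shows "\<bar>trapezoid_kernel p q t\<bar> \<le> (p powr \<epsilon> + q powr - \<epsilon>) * decay \<epsilon> t"
proof (cases "\<bar>t\<bar> \<le> 1")
  case True
  have "\<bar>trapezoid_kernel p q t\<bar> = p * \<bar>sinc (p * t)\<bar> * \<bar>sinc (q * t)\<bar>"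
    using assms by (simp only: trapezoid_kernel_def abs_mult)
  also have "\<dots> \<le> p * \<bar>p * t\<bar> powr - (1 - \<epsilon>) * \<bar>q * t\<bar> powr - 0"
    using assms by (intro mult_mono abs_sinc_le) auto
  also have "\<dots> = p powr \<epsilon> * \<bar>t\<bar> powr (\<epsilon> - 1)"
    using assms by (simp add: abs_mult powr_mult powr_diff)
  also have "\<dots> \<le> (p powr \<epsilon> + q powr - \<epsilon>) * \<bar>t\<bar> powr (\<epsilon> - 1)"
    by (intro mult_right_mono) auto
  finally show ?thesis using True by (simp add: decay_def)
next
  case False
  have "\<bar>trapezoid_kernel p q t\<bar> = p * \<bar>sinc (p * t)\<bar> * \<bar>sinc (q * t)\<bar>"
    using assms by (simp only: trapezoid_kernel_def abs_mult)
  also have "\<dots> \<le> p * \<bar>p * t\<bar> powr - 1 * \<bar>q * t\<bar> powr - \<epsilon>"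
    using assms by (intro mult_mono abs_sinc_le) auto
  also have "\<dots> = q powr - \<epsilon> * (\<bar>t\<bar> powr (- 1) * \<bar>t\<bar> powr (- \<epsilon>))"
    using assms by (simp add: abs_mult powr_mult powr_minus)
  also have "\<dots> = q powr - \<epsilon> * \<bar>t\<bar> powr (- 1 - \<epsilon>)"
    by (simp only: powr_add[symmetric] add_uminus_conv_diff)
  also have "\<dots> \<le> (p powr \<epsilon> + q powr - \<epsilon>) * \<bar>t\<bar> powr (- 1 - \<epsilon>)"
    by (intro mult_right_mono) auto
  finally show ?thesis using False by (simp add: decay_def)
qed

section \<open>Integrability of the kernel and Fejer integrals\<close>

lemma AE_lborel_nonzero: "AE t in lborel. t \<noteq> (0::real)"
  by (rule AE_lborel_singleton)

lemma integrable_trapezoid_kernel: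
  assumes "0 < p" "0 < q"
  shows "integrable lborel (trapezoid_kernel p q)"
proof (rule Bochner_Integration.integrable_bound)
  show "integrable lborel (\<lambda>t. (p powr 1 + q powr - 1) * decay 1 t)"
    by (intro integrable_mult_right integrable_decay) auto
  show "AE t in lborel. norm (trapezoid_kernel p q t) \<le> norm ((p powr 1 + q powr - 1) * decay 1 t)"
    using AE_lborel_nonzero
  proof eventually_elim
    case (elim t)
    thus ?case using abs_trapezoid_kernel_le[of 1 p q t] assms by simp
  qed
qed simp

text \<open>
  The constant \<open>fejer_mass\<close> is \<open>\<pi>\<close>, but only its positivity matters: scaling alone shows that the
  integral of \<open>fejer c\<close> is proportional to \<open>\<bar>c\<bar>\<close>.
\<close>

definition fejer :: "real \<Rightarrow> real \<Rightarrow> real" where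
  "fejer c t = (1 - cos (c * t)) / t\<^sup>2"

lemma fejer_measurable [measurable]: "fejer c \<in> borel_measurable borel"
  unfolding fejer_def by measurable

lemma integrable_fejer: "integrable lborel (fejer c)"
proof (cases "c = 0")
  case True
  thus ?thesis by (simp add: fejer_def[abs_def])
next
  case False
  \<comment> \<open>By the half-angle formula, \<open>fejer c\<close> equals \<open>2 * p\<close>
    times the kernel with both parameters \<open>p\<close>, except at 0.\<close>
  define p where "p = \<bar>c\<bar> / 2"
  have p: "0 < p" using False by (simp add: p_def)
  have "integrable lborel (\<lambda>t. 2 * p * trapezoid_kernel p p t)"
    by (intro integrable_mult_right integrable_trapezoid_kernel p)
  moreover have "AE t in lborel. 2 * p * trapezoid_kernel p p t = fejer c t"
    using AE_lborel_nonzero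
  proof eventually_elim
    case (elim t)
    have "cos (c * t) = cos (2 * (p * t))" by (simp add: p_def abs_if)
    also have "\<dots> = 1 - 2 * sin (p * t) * sin (p * t)" by (simp add: cos_double_sin power2_eq_square)
    finally show ?case using p elim by (simp add: trapezoid_kernel_eq fejer_def field_simps)
  qed
  ultimately show ?thesis by (subst (asm) integrable_cong_AE) auto
qed

definition fejer_mass :: real where
  "fejer_mass = integral\<^sup>L lborel (fejer 1)"

lemma integral_fejer: "integral\<^sup>L lborel (fejer c) = fejer_mass * \<bar>c\<bar>"
proof (cases "c = 0")
  case True
  thus ?thesis by (simp add: fejer_def[abs_def])
next
  case False
  have "fejer_mass = \<bar>c\<bar> *\<^sub>R (\<integral>t. fejer 1 (0 + c * t) \<partial>lborel)"
    unfolding fejer_mass_def using False by (rule lborel_integral_real_affine)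
  also have "(\<integral>t. fejer 1 (0 + c * t) \<partial>lborel) = (\<integral>t. fejer c t / c\<^sup>2 \<partial>lborel)"
    by (intro Bochner_Integration.integral_cong) (auto simp: fejer_def power_mult_distrib mult.commute)
  also have "\<dots> = integral\<^sup>L lborel (fejer c) / \<bar>c\<bar>\<^sup>2" by simp
  finally show ?thesis using False by (auto simp: power2_eq_square field_simps abs_if split: if_splits)
qed

lemma fejer_mass_pos: "0 < fejer_mass"
proof -
  \<comment> \<open>On [1,2] the cosine is at most cos 1 and the denominator at most 4, so
    \<open>\<delta>\<close> bounds \<open>fejer 1\<close> from below there; elsewhere
    \<open>fejer 1\<close> is nonnegative.\<close>
  define \<delta> where "\<delta> = (1 - cos (1::real)) / 4"
  have \<delta>: "0 < \<delta>" using cos_monotone_0_pi[of 0 1] pi_gt3 by (simp add: \<delta>_def)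
  have le: "indicat_real {1..2} t * \<delta> \<le> fejer 1 t" for t
  proof (cases "t \<in> {1..2}")
    case True
    hence "cos t \<le> cos 1" "t\<^sup>2 \<le> 2\<^sup>2"
      using pi_gt3 power_mono[of t 2 2] by (auto intro!: cos_monotone_0_pi_le)
    hence "(1 - cos 1) / 4 \<le> (1 - cos t) / t\<^sup>2"
      using True cos_le_one[of 1] by (intro frac_le) auto
    thus ?thesis using True by (simp add: \<delta>_def fejer_def)
  qed (auto simp: fejer_def)
  have "0 < \<delta>" by (rule \<delta>)
  also have "\<delta> = (\<integral>t. indicat_real {1..2::real} t * \<delta> \<partial>lborel)" by simp
  also have "\<dots> \<le> fejer_mass"
    unfolding fejer_mass_def using le by (intro integral_mono integrable_fejer) auto
  finally show ?thesis .
qed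

text \<open>Product-to-sum formulas turn the integrand into four cosines over the square of
  \<open>t\<close>. Their coefficients add up to 0, so each cosine may be replaced by its difference
  from 1, which gives a signed sum of four integrable \<open>fejer\<close> functions.\<close>

lemma integral_trapezoid_kernel_cos:
  assumes "0 < p" "0 < q"
  shows "(\<integral>t. trapezoid_kernel p q t * cos (u * t) \<partial>lborel)
    = fejer_mass / (4 * q) * (\<bar>p + q + u\<bar> + \<bar>p + q - u\<bar> - \<bar>p - q + u\<bar> - \<bar>p - q - u\<bar>)"
proof -
  have "(\<integral>t. trapezoid_kernel p q t * cos (u * t) \<partial>lborel)
    = (\<integral>t. 1 / (4 * q) * (fejer (p + q + u) t + fejer (p + q - u) t - fejer (p - q + u) t - fejer (p - q - u) t) \<partial>lborel)"
  proof (rule integral_cong_AE)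
    show "AE t in lborel. trapezoid_kernel p q t * cos (u * t)
      = 1 / (4 * q) * (fejer (p + q + u) t + fejer (p + q - u) t - fejer (p - q + u) t - fejer (p - q - u) t)"
      using AE_lborel_nonzero
    proof eventually_elim
      case (elim t)
      have product: "sin x * sin y * cos z = (cos (x - y + z) + cos (x - y - z) - cos (x + y + z) - cos (x + y - z)) / 4"
        for x y z :: real
        by (simp add: cos_add cos_diff sin_add sin_diff field_simps)
      have "sin (p * t) * sin (q * t) * cos (u * t) = (cos ((p - q + u) * t) + cos ((p - q - u) * t)
         - cos ((p + q + u) * t) - cos ((p + q - u) * t)) / 4"
        unfolding product by (simp add: algebra_simps)
      thus ?case using elim assms by (simp add: trapezoid_kernel_eq fejer_def divide_simps)
    qed
  qed measurable
  also have "\<dots> = 1 / (4 * q) * (fejer_mass * (\<bar>p + q + u\<bar> + \<bar>p + q - u\<bar> - \<bar>p - q + u\<bar> - \<bar>p - q - u\<bar>))"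
    by (simp add: integrable_fejer integral_fejer algebra_simps)
  finally show ?thesis by simp
qed

lemma integrable_trapezoid_kernel_times:
  fixes g :: "real \<Rightarrow> complex"
  assumes "0 < p" "0 < q" and g[measurable]: "g \<in> borel_measurable borel" and "\<And>t. cmod (g t) \<le> M"
  shows "integrable lborel (\<lambda>t. of_real (trapezoid_kernel p q t) * g t)"
proof (rule Bochner_Integration.integrable_bound)
  show "integrable lborel (\<lambda>t. M * trapezoid_kernel p q t)"
    by (intro integrable_mult_right integrable_trapezoid_kernel assms)
  have "0 \<le> M" using norm_ge_zero assms(4) order_trans by blast
  thus "AE t in lborel. norm (of_real (trapezoid_kernel p q t) * g t) \<le> norm (M * trapezoid_kernel p q t)"
    using assms(4) by (auto simp: norm_mult abs_mult mult.commute intro!: mult_right_mono)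
qed measurable

lemma integral_trapezoid_kernel_cis:
  assumes "0 < p" "0 < q"
  shows "(\<integral>t. of_real (trapezoid_kernel p q t) * cis (- (u * t)) \<partial>lborel)
    = of_real (fejer_mass / (4 * q) * (\<bar>p + q + u\<bar> + \<bar>p + q - u\<bar> - \<bar>p - q + u\<bar> - \<bar>p - q - u\<bar>))"
    (is "?I = of_real ?c")
proof -
  have int: "integrable lborel (\<lambda>t. of_real (trapezoid_kernel p q t) * cis (- (u * t)))"
    by (rule integrable_trapezoid_kernel_times[where M = 1]) (use assms in \<open>auto simp: cis_conv_exp\<close>)
  have "Re ?I = (\<integral>t. trapezoid_kernel p q t * cos (u * t) \<partial>lborel)"
    using integral_Re[OF int] by simp
  also have "\<dots> = ?c" using assms by (rule integral_trapezoid_kernel_cos)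
  finally have "Re ?I = ?c" .
  moreover have "Im ?I = (\<integral>t. trapezoid_kernel p q t * sin (- (u * t)) \<partial>lborel)"
    using integral_Im[OF int] by simp
  \<comment> \<open>Substituting -t for t in an even kernel shows that the imaginary part equals its
    own negative, so it vanishes.\<close>
  moreover have "(\<integral>t. trapezoid_kernel p q t * sin (- (u * t)) \<partial>lborel)
     = (\<integral>t. trapezoid_kernel p q t * sin (u * t) \<partial>lborel)"
    using lborel_integral_real_affine[of "-1" "\<lambda>t. trapezoid_kernel p q t * sin (- (u * t))" 0]
    by (simp add: trapezoid_kernel_even)
  ultimately show ?thesis by (simp add: complex_eq_iff)
qed

section \<open>Bohr's theorem\<close>

lemma open_halfplane: "open (halfplane \<sigma>)"
  unfolding halfplane_def by (rule open_halfspace_Re_gt)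

lemma convex_halfplane: "convex (halfplane \<sigma>)"
  unfolding halfplane_def by (rule convex_halfspace_Re_gt)

lemma connected_halfplane: "connected (halfplane \<sigma>)"
  by (intro convex_connected convex_halfplane)

lemma halfplane_analytic_continuation:
  assumes "f holomorphic_on halfplane \<sigma>" "g holomorphic_on halfplane \<sigma>" "s \<in> halfplane \<sigma>"
    and "\<And>z. \<tau> < Re z \<Longrightarrow> f z = g z"
  shows "f s = g s"
proof (rule analytic_continuation_open[where f = f and g = g])
  show "open (halfplane (max \<sigma> \<tau>))" "open (halfplane \<sigma>)" by (rule open_halfplane)+
  show "connected (halfplane \<sigma>)" by (rule connected_halfplane)
  have "of_real (max \<sigma> \<tau> + 1) \<in> halfplane (max \<sigma> \<tau>)"
    unfolding halfplane_def mem_Collect_eq Re_complex_of_real by simp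
  thus "halfplane (max \<sigma> \<tau>) \<noteq> {}" by blast
qed (use assms in \<open>auto simp: halfplane_def\<close>)

lemma vertical_line_measurable:
  assumes "f holomorphic_on halfplane 0" "0 < Re s"
  shows "(\<lambda>t. f (s + \<i> * of_real t)) \<in> borel_measurable borel"
  using assms(2) by (intro borel_measurable_continuous_onI
      continuous_on_compose2[OF holomorphic_on_imp_continuous_on[OF assms(1)]] continuous_intros)
    (auto simp: halfplane_def)

text \<open>The integrals over [-n,n] are holomorphic by differentiation under the integral sign.
  They converge locally uniformly, because the error is at most a local bound of \<open>f\<close>
  times the mass of \<open>\<bar>k\<bar>\<close> outside [-n,n].\<close>

lemma holomorphic_vertical_convolution:
  fixes k :: "real \<Rightarrow> real"
  assumes hol: "f holomorphic_on halfplane 0"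
    and bdd: "\<And>\<sigma>. 0 < \<sigma> \<Longrightarrow> \<exists>M. \<forall>s\<in>halfplane \<sigma>. cmod (f s) \<le> M"
    and cont: "continuous_on UNIV k" and int: "integrable lborel k"
  shows "(\<lambda>s. \<integral>t. of_real (k t) * f (s + \<i> * of_real t) \<partial>lborel) holomorphic_on halfplane 0"
proof -
  define F where "F s t = of_real (k t) * f (s + \<i> * of_real t)" for s t
  define G where "G n s = integral (cbox (- real n) (real n)) (F s)" for n s
  have [measurable]: "k \<in> borel_measurable borel"
    using cont by (rule borel_measurable_continuous_onI)
  have cont_f: "continuous_on A (\<lambda>x. f (u x))" if "continuous_on A u" "\<And>x. x \<in> A \<Longrightarrow> 0 < Re (u x)"
    for A :: "'x::topological_space set" and u
    using that by (intro continuous_on_compose2[OF holomorphic_on_imp_continuous_on[OF hol]])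
      (auto simp: halfplane_def)
  have cont_f': "continuous_on A (\<lambda>x. deriv f (u x))" if "continuous_on A u" "\<And>x. x \<in> A \<Longrightarrow> 0 < Re (u x)"
    for A :: "'x::topological_space set" and u
    using that hol open_halfplane
    by (intro continuous_on_compose2[OF holomorphic_on_imp_continuous_on[OF holomorphic_deriv]])
      (auto simp: halfplane_def)
  have cont_k: "continuous_on A (\<lambda>x. k (u x))" if "continuous_on A u"
    for A :: "'x::topological_space set" and u
    using that by (intro continuous_on_compose2[OF cont]) auto
  have G_hol: "G n holomorphic_on halfplane 0" for n
    unfolding G_def
  proof (rule leibniz_rule_holomorphic)
    show "((\<lambda>s. F s t) has_field_derivative of_real (k t) * deriv f (s + \<i> * of_real t)) (at s within halfplane 0)"
      if "s \<in> halfplane 0" for s t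
    proof -
      have "(f has_field_derivative deriv f (s + \<i> * of_real t)) (at (s + \<i> * of_real t))"
        using hol open_halfplane that by (intro holomorphic_derivI[of f "halfplane 0"]) (auto simp: halfplane_def)
      moreover have "((\<lambda>s. s + \<i> * of_real t) has_field_derivative 1) (at s within halfplane 0)"
        by (auto intro!: derivative_eq_intros)
      ultimately have "((\<lambda>s. f (s + \<i> * of_real t)) has_field_derivative deriv f (s + \<i> * of_real t) * 1)
          (at s within halfplane 0)"
        by (rule DERIV_chain2)
      thus ?thesis unfolding F_def by (intro DERIV_cmult) simp
    qed
    show "F s integrable_on cbox (- real n) (real n)" if "s \<in> halfplane 0" for s
      unfolding F_def using that
      by (intro integrable_continuous continuous_intros cont_f continuous_on_subset[OF cont])
        (auto simp: halfplane_def)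
    show "continuous_on (halfplane 0 \<times> cbox (- real n) (real n))
        (\<lambda>(s, t). of_real (k t) * deriv f (s + \<i> * of_real t))"
      unfolding case_prod_beta' by (intro continuous_intros cont_f' cont_k) (auto simp: halfplane_def)
  qed (rule convex_halfplane)
  \<comment> \<open>The mass of \<open>\<bar>k\<bar>\<close> outside [-n,n], which tends to 0 by
    dominated convergence.\<close>
  define \<tau> where "\<tau> n = (\<integral>t. indicator (- {- real n..real n}) t * \<bar>k t\<bar> \<partial>lborel)" for n
  have "\<tau> \<longlonglongrightarrow> (\<integral>t. 0 \<partial>(lborel :: real measure))" unfolding \<tau>_def
  proof (rule integral_dominated_convergence[where w = "\<lambda>t. \<bar>k t\<bar>"])
    show "AE t in lborel. (\<lambda>n. indicator (- {- real n..real n}) t * \<bar>k t\<bar>) \<longlonglongrightarrow> 0"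
    proof (rule AE_I2)
      fix t :: real
      have "eventually (\<lambda>n. indicator (- {- real n..real n}) t * \<bar>k t\<bar> = 0) sequentially"
        using eventually_ge_at_top[of "nat \<lceil>\<bar>t\<bar>\<rceil>"]
      proof eventually_elim
        case (elim n)
        hence "\<bar>t\<bar> \<le> real n" by linarith
        thus ?case by (auto simp: indicator_def)
      qed
      thus "(\<lambda>n. indicator (- {- real n..real n}) t * \<bar>k t\<bar>) \<longlonglongrightarrow> 0"
        by (rule tendsto_eventually)
    qed
  qed (use int in \<open>auto simp: indicator_def\<close>)
  hence tau: "\<tau> \<longlonglongrightarrow> 0" by simp
  have "(\<lambda>s. integral\<^sup>L lborel (F s)) holomorphic_on halfplane 0"
  proof (rule holomorphic_uniform_sequence[where f = G, OF open_halfplane G_hol])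
    fix z assume z: "z \<in> halfplane 0"
    \<comment> \<open>The closed ball of this radius stays in real part at least \<open>d\<close>,
      hence inside the open half-plane of abscissa \<open>d/2\<close>, where one bound serves all
      vertical lines through the ball.\<close>
    define d where "d = Re z / 2"
    have d: "0 < d" using z by (simp add: d_def halfplane_def)
    have Re: "d \<le> Re s" if "s \<in> cball z d" for s
      using that abs_Re_le_cmod[of "z - s"] by (simp add: d_def dist_norm field_simps)
    obtain M where M: "\<And>s. s \<in> halfplane (d/2) \<Longrightarrow> cmod (f s) \<le> M"
      using bdd[of "d/2"] d by auto
    define M' where "M' = max M 1"
    have "M' > 0" by (simp add: M'_def)
    have ulim: "uniform_limit (cball z d) G (\<lambda>s. integral\<^sup>L lborel (F s)) sequentially"
    proof (rule uniform_limitI)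
      fix e :: real assume "0 < e"
      hence "eventually (\<lambda>n. \<tau> n < e / M') sequentially"
        using tau \<open>M' > 0\<close> by (intro order_tendstoD(2)) auto
      thus "\<forall>\<^sub>F n in sequentially. \<forall>s\<in>cball z d. dist (G n s) (integral\<^sup>L lborel (F s)) < e"
      proof eventually_elim
        case (elim n)
        show ?case
        proof
          fix s assume s: "s \<in> cball z d"
          have Res: "0 < Re s" using Re[OF s] d by simp
          have bound: "cmod (f (s + \<i> * of_real t)) \<le> M'" for t
            using M[of "s + \<i> * of_real t"] Re[OF s] d by (auto simp: halfplane_def M'_def)
          have [measurable]: "(\<lambda>t. f (s + \<i> * of_real t)) \<in> borel_measurable borel"
            using hol Res by (rule vertical_line_measurable)
          have F_le: "cmod (F s t) \<le> M' * \<bar>k t\<bar>" for t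
            using mult_left_mono[OF bound[of t], of "\<bar>k t\<bar>"] by (simp add: F_def norm_mult mult.commute)
          have F_int: "integrable lborel (F s)"
          proof (rule Bochner_Integration.integrable_bound)
            show "integrable lborel (\<lambda>t. M' * k t)" using int by simp
            show "F s \<in> borel_measurable lborel" unfolding F_def by measurable
          qed (use F_le \<open>M' > 0\<close> in \<open>auto simp: abs_mult\<close>)
          have "set_integrable lborel (cbox (- real n) (real n)) (F s)"
            using integrable_mult_indicator[OF _ F_int, of "cbox (- real n) (real n)"]
            by (simp add: set_integrable_def)
          hence "G n s = (\<integral>t. indicator (cbox (- real n) (real n)) t *\<^sub>R F s t \<partial>lborel)"
            unfolding G_def using set_borel_integral_eq_integral(2)
            by (metis set_lebesgue_integral_def)
          hence "G n s - integral\<^sup>L lborel (F s)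
              = (\<integral>t. indicator (cbox (- real n) (real n)) t *\<^sub>R F s t - F s t \<partial>lborel)"
            using integrable_mult_indicator[OF _ F_int, of "cbox (- real n) (real n)"] F_int
            by (subst Bochner_Integration.integral_diff) auto
          also have "cmod \<dots> \<le> (\<integral>t. cmod (indicator (cbox (- real n) (real n)) t *\<^sub>R F s t - F s t) \<partial>lborel)"
            by (rule integral_norm_bound)
          also have "\<dots> \<le> (\<integral>t. M' * (indicator (- {- real n..real n}) t * \<bar>k t\<bar>) \<partial>lborel)"
          proof (rule integral_mono)
            show "integrable lborel (\<lambda>t. cmod (indicator (cbox (- real n) (real n)) t *\<^sub>R F s t - F s t))"
              using integrable_mult_indicator[OF _ F_int, of "cbox (- real n) (real n)"] F_int
              by (intro integrable_norm Bochner_Integration.integrable_diff) auto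
            show "integrable lborel (\<lambda>t. M' * (indicator (- {- real n..real n}) t * \<bar>k t\<bar>))"
              using integrable_mult_indicator[OF _ integrable_abs[OF int], of "- {- real n..real n}"]
              by (intro integrable_mult_right) auto
            show "cmod (indicator (cbox (- real n) (real n)) t *\<^sub>R F s t - F s t)
              \<le> M' * (indicator (- {- real n..real n}) t * \<bar>k t\<bar>)" for t
              using F_le[of t] by (auto simp: indicator_def)
          qed
          also have "\<dots> = M' * \<tau> n" by (simp add: \<tau>_def)
          also have "\<dots> < e" using elim \<open>M' > 0\<close> by (simp add: field_simps)
          finally show "dist (G n s) (integral\<^sup>L lborel (F s)) < e" by (simp add: dist_norm)
        qed
      qed
    qed
    have "cball z d \<subseteq> halfplane 0" using Re d by (force simp: halfplane_def)
    with d ulim show "\<exists>d>0. cball z d \<subseteq> halfplane 0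
        \<and> uniform_limit (cball z d) G (\<lambda>s. integral\<^sup>L lborel (F s)) sequentially" by blast
  qed
  thus ?thesis unfolding F_def .
qed

text \<open>On a vertical line each term is a pure oscillation of frequency ln(n+1), so convolution
  with a kernel multiplies it by the Fourier transform at that frequency.\<close>

lemma dirichlet_term_vertical:
  "dirichlet_term a (s + \<i> * of_real t) n = dirichlet_term a s n * cis (- (ln (real (Suc n)) * t))"
proof -
  have "Ln (of_nat (Suc n)) = of_real (ln (real (Suc n)))"
    by (subst Ln_of_real[symmetric]) auto
  thus ?thesis
    by (simp add: dirichlet_term_def powr_def cis_conv_exp exp_add[symmetric] algebra_simps del: of_nat_Suc)
qed

text \<open>The choice of \<open>p\<close> and \<open>q\<close> means p-q = ln N and p+q = ln(N+1).
  No frequency ln(n+1) falls strictly inside the slopes of the trapezoid, so the cut-off is sharp: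
  terms with \<open>n < N\<close> lie on the plateau and the others outside the support.\<close>

lemma dirichlet_partial_sum_eq_integral:
  assumes hol: "f holomorphic_on halfplane 0"
    and bdd: "\<And>\<sigma>. 0 < \<sigma> \<Longrightarrow> \<exists>M. \<forall>s\<in>halfplane \<sigma>. cmod (f s) \<le> M"
    and abs_sum: "summable (\<lambda>n. cmod (dirichlet_term b (of_real \<tau>) n))"
    and sums: "\<And>s. \<tau> \<le> Re s \<Longrightarrow> dirichlet_term b s sums f s"
    and N: "0 < N" and p: "p = (ln (real (Suc N)) + ln (real N)) / 2" and q: "q = (ln (real (Suc N)) - ln (real N)) / 2"
    and s: "0 < Re s"
  shows "of_real fejer_mass * (\<Sum>n<N. dirichlet_term b s n)
    = (\<integral>t. of_real (trapezoid_kernel p q t) * f (s + \<i> * of_real t) \<partial>lborel)" (is "?S s = ?G s")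
proof (rule halfplane_analytic_continuation[where f = ?S and g = ?G])
  have lnN: "0 \<le> ln (real N)" "ln (real N) < ln (real (Suc N))" using N by auto
  hence pq: "0 < p" "0 < q" unfolding p q by auto
  show "?S holomorphic_on halfplane 0"
    unfolding dirichlet_term_def by (intro holomorphic_intros)
  show "?G holomorphic_on halfplane 0"
    by (intro holomorphic_vertical_convolution hol bdd continuous_on_trapezoid_kernel
        integrable_trapezoid_kernel pq)
  show "s \<in> halfplane 0" using s by (simp add: halfplane_def)
  fix z assume z: "max \<tau> 0 < Re z"
  have term_int: "integrable lborel (\<lambda>t. of_real (trapezoid_kernel p q t) * dirichlet_term b (z + \<i> * of_real t) n)" for n
    unfolding dirichlet_term_vertical
    by (rule integrable_trapezoid_kernel_times[OF pq, where M = "cmod (dirichlet_term b z n)"])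
      (auto simp: norm_mult cis_conv_exp simp del: of_nat_Suc)
  have summ_z: "summable (\<lambda>n. cmod (dirichlet_term b z n))"
    by (rule summable_comparison_test'[OF abs_sum, of 0]) (use z norm_dirichlet_term_mono in auto)
  have coeff: "fejer_mass / (4 * q) * (\<bar>p + q + u\<bar> + \<bar>p + q - u\<bar> - \<bar>p - q + u\<bar> - \<bar>p - q - u\<bar>)
      = (if n < N then fejer_mass else 0)" if u: "u = ln (real (Suc n))" for n u
  proof (cases "n < N")
    case True
    hence "0 \<le> u" "u \<le> p - q" unfolding u p q using N by (auto simp: field_simps)
    thus ?thesis using True pq by (simp add: field_simps)
  next
    case False
    hence "p + q \<le> u" unfolding u p q using N by (auto simp: field_simps)
    thus ?thesis using False pq lnN by (simp add: p q field_simps)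
  qed
  have "?G z = (\<integral>t. (\<Sum>n. of_real (trapezoid_kernel p q t) * dirichlet_term b (z + \<i> * of_real t) n) \<partial>lborel)"
  proof (intro Bochner_Integration.integral_cong refl)
    fix t :: real
    have "dirichlet_term b (z + \<i> * of_real t) sums f (z + \<i> * of_real t)" using z by (intro sums) auto
    thus "of_real (trapezoid_kernel p q t) * f (z + \<i> * of_real t)
      = (\<Sum>n. of_real (trapezoid_kernel p q t) * dirichlet_term b (z + \<i> * of_real t) n)"
      by (simp add: suminf_mult sums_iff)
  qed
  \<comment> \<open>The interchange is justified because the norm of a term is constant along the
    vertical line, so the integrals of the norms form a multiple of an absolutely convergent
    series.\<close>
  also have "\<dots> = (\<Sum>n. \<integral>t. of_real (trapezoid_kernel p q t) * dirichlet_term b (z + \<i> * of_real t) n \<partial>lborel)"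
  proof (rule integral_suminf[OF term_int])
    show "AE t in lborel. summable (\<lambda>n. norm (of_real (trapezoid_kernel p q t) * dirichlet_term b (z + \<i> * of_real t) n))"
      using summ_z by (auto simp: dirichlet_term_vertical norm_mult intro!: AE_I2 summable_mult)
    show "summable (\<lambda>n. \<integral>t. norm (of_real (trapezoid_kernel p q t) * dirichlet_term b (z + \<i> * of_real t) n) \<partial>lborel)"
      using summ_z by (auto simp: dirichlet_term_vertical norm_mult intro!: summable_mult)
  qed
  also have "\<dots> = (\<Sum>n. if n < N then of_real fejer_mass * dirichlet_term b z n else 0)"
  proof (intro suminf_cong)
    fix n
    have "(\<integral>t. of_real (trapezoid_kernel p q t) * dirichlet_term b (z + \<i> * of_real t) n \<partial>lborel)
      = dirichlet_term b z n * (\<integral>t. of_real (trapezoid_kernel p q t) * cis (- (ln (real (Suc n)) * t)) \<partial>lborel)"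
      unfolding dirichlet_term_vertical by (simp add: mult.left_commute del: of_nat_Suc)
    thus "(\<integral>t. of_real (trapezoid_kernel p q t) * dirichlet_term b (z + \<i> * of_real t) n \<partial>lborel)
      = (if n < N then of_real fejer_mass * dirichlet_term b z n else 0)"
      unfolding integral_trapezoid_kernel_cis[OF pq] coeff[OF refl] by simp
  qed
  also have "\<dots> = ?S z"
    by (subst suminf_finite[where N = "{..<N}"]) (auto simp: sum_distrib_left)
  finally show "?S z = ?G z" ..
qed

text \<open>In the integral formula \<open>f\<close> is bounded by \<open>M\<close> on the whole
  line, so only the L1 norm of the kernel matters. It is controlled by \<open>p \<le> N\<close> and
  \<open>q \<ge> 1/(4N)\<close>.\<close>

lemma dirichlet_partial_sum_bound:
  assumes hol: "f holomorphic_on halfplane 0"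
    and bdd: "\<And>\<sigma>. 0 < \<sigma> \<Longrightarrow> \<exists>M. \<forall>s\<in>halfplane \<sigma>. cmod (f s) \<le> M"
    and abs_sum: "summable (\<lambda>n. cmod (dirichlet_term b (of_real \<tau>) n))"
    and sums: "\<And>s. \<tau> \<le> Re s \<Longrightarrow> dirichlet_term b s sums f s"
    and \<epsilon>: "0 < \<epsilon>" "\<epsilon> \<le> 1" and \<sigma>: "0 < \<sigma>"
  shows "\<exists>C. \<forall>s\<in>halfplane \<sigma>. \<forall>N>0. cmod (\<Sum>n<N. dirichlet_term b s n) \<le> C * real N powr \<epsilon>"
proof -
  obtain M where M: "\<And>s. s \<in> halfplane \<sigma> \<Longrightarrow> cmod (f s) \<le> M"
    using bdd[OF \<sigma>] by blast
  define I where "I = integral\<^sup>L lborel (decay \<epsilon>)"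
  have "of_real (\<sigma> + 1) \<in> halfplane \<sigma>" by (simp add: halfplane_def)
  from order_trans[OF norm_ge_zero M[OF this]] have "0 \<le> M" .
  have "0 \<le> I" unfolding I_def by (intro integral_nonneg_AE) (simp add: decay_nonneg)
  have "cmod (\<Sum>n<N. dirichlet_term b s n) \<le> M * I * (1 + 4 powr \<epsilon>) / fejer_mass * real N powr \<epsilon>"
    if s: "s \<in> halfplane \<sigma>" and N: "0 < N" for s N
  proof -
    define p q where p: "p = (ln (real (Suc N)) + ln (real N)) / 2"
      and q: "q = (ln (real (Suc N)) - ln (real N)) / 2"
    have lnN: "0 \<le> ln (real N)" "ln (real N) < ln (real (Suc N))" using N by auto
    hence pq: "0 < p" "0 < q" unfolding p q by auto
    have "p \<le> real N"
      using ln_le_minus_one[of "real (Suc N)"] lnN N unfolding p by (simp del: ln_less_cancel_iff)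
    hence p_le: "p powr \<epsilon> \<le> real N powr \<epsilon>" using pq \<epsilon> by (intro powr_mono2) auto
    \<comment> \<open>The left side is \<open>- 2 * q\<close>, so ln x <= x - 1 bounds
      \<open>q\<close> from below by half of 1/(N+1), and N+1 is at most 2N.\<close>
    have "ln (real N / real (Suc N)) \<le> real N / real (Suc N) - 1"
      using N by (intro ln_le_minus_one) auto
    also have "\<dots> = - (1 / real (Suc N))" by (simp add: field_simps)
    finally have "1 / real (Suc N) \<le> 2 * q" unfolding q using N by (simp add: ln_div)
    moreover have "1 / (2 * real N) \<le> 1 / real (Suc N)" using N by (intro divide_left_mono) auto
    ultimately have "1 / (4 * real N) \<le> q" by simp
    hence "inverse q \<le> 4 * real N" using pq N by (simp add: field_simps)
    hence "inverse q powr \<epsilon> \<le> (4 * real N) powr \<epsilon>" using pq \<epsilon> by (intro powr_mono2) auto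
    hence q_le: "q powr - \<epsilon> \<le> 4 powr \<epsilon> * real N powr \<epsilon>"
      by (simp add: powr_mult powr_minus inverse_powr pq less_imp_le)
    have Res: "0 < Re s" using s \<sigma> by (simp add: halfplane_def)
    have [measurable]: "(\<lambda>t. f (s + \<i> * of_real t)) \<in> borel_measurable borel"
      using hol Res by (rule vertical_line_measurable)
    have fM: "cmod (f (s + \<i> * of_real t)) \<le> M" for t
      using s by (intro M) (simp add: halfplane_def)
    have "fejer_mass * cmod (\<Sum>n<N. dirichlet_term b s n)
        = cmod (of_real fejer_mass * (\<Sum>n<N. dirichlet_term b s n))"
      using fejer_mass_pos by (simp add: norm_mult)
    also have "\<dots> = cmod (\<integral>t. of_real (trapezoid_kernel p q t) * f (s + \<i> * of_real t) \<partial>lborel)"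
      using dirichlet_partial_sum_eq_integral[OF hol bdd abs_sum sums N p q Res] by (rule arg_cong)
    also have "\<dots> \<le> (\<integral>t. cmod (of_real (trapezoid_kernel p q t) * f (s + \<i> * of_real t)) \<partial>lborel)"
      by (rule integral_norm_bound)
    also have "\<dots> \<le> (\<integral>t. M * (p powr \<epsilon> + q powr - \<epsilon>) * decay \<epsilon> t \<partial>lborel)"
    proof (rule integral_mono_AE)
      show "integrable lborel (\<lambda>t. cmod (of_real (trapezoid_kernel p q t) * f (s + \<i> * of_real t)))"
        by (intro integrable_norm integrable_trapezoid_kernel_times[OF pq _ fM]) measurable
      show "integrable lborel (\<lambda>t. M * (p powr \<epsilon> + q powr - \<epsilon>) * decay \<epsilon> t)"
        by (intro integrable_mult_right integrable_decay \<epsilon>)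
      show "AE t in lborel. cmod (of_real (trapezoid_kernel p q t) * f (s + \<i> * of_real t))
         \<le> M * (p powr \<epsilon> + q powr - \<epsilon>) * decay \<epsilon> t"
        using AE_lborel_nonzero
      proof eventually_elim
        case (elim t)
        have "\<bar>trapezoid_kernel p q t\<bar> * cmod (f (s + \<i> * of_real t))
            \<le> ((p powr \<epsilon> + q powr - \<epsilon>) * decay \<epsilon> t) * M"
          using abs_trapezoid_kernel_le[OF \<epsilon> pq elim] fM[of t] \<open>0 \<le> M\<close>
          by (intro mult_mono) (auto simp: decay_nonneg)
        thus ?case by (simp add: norm_mult mult_ac)
      qed
    qed
    also have "\<dots> = M * I * (p powr \<epsilon> + q powr - \<epsilon>)" by (simp add: I_def)
    also have "\<dots> \<le> M * I * ((1 + 4 powr \<epsilon>) * real N powr \<epsilon>)"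
      using p_le q_le \<open>0 \<le> M\<close> \<open>0 \<le> I\<close> by (intro mult_left_mono) (auto simp: algebra_simps)
    finally show ?thesis using fejer_mass_pos by (simp add: field_simps)
  qed
  thus ?thesis by blast
qed

section \<open>Summation by parts: from bounds on partial sums to convergence\<close>

lemma abel_summation:
  fixes c w :: "nat \<Rightarrow> complex"
  shows "(\<Sum>n<N. c n * w n) = (\<Sum>n<N. c n) * w N + (\<Sum>n<N. (\<Sum>i<Suc n. c i) * (w n - w (Suc n)))"
  by (induction N) (simp_all add: algebra_simps)

lemma dirichlet_uniform_limit_of_partial_sum_bound:
  assumes \<epsilon>: "0 < \<epsilon>"
    and bound: "\<And>s N. s \<in> S \<Longrightarrow> 0 < N \<Longrightarrow> cmod (\<Sum>n<N. dirichlet_term b s n) \<le> C * real N powr \<epsilon>"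
  shows "\<exists>g. uniform_limit S (\<lambda>N s. \<Sum>n<N. dirichlet_term b (s + of_real (2 * \<epsilon>)) n) g sequentially"
proof -
  \<comment> \<open>With weights \<open>v\<^sup>2\<close> instead of \<open>v\<close>, the differences satisfy
    \<open>(v n)\<^sup>2 - (v (n+1))\<^sup>2 \<le> 2 v n (v n - v (n+1))\<close>, so the factor \<open>v n\<close> absorbs the growth of the partial
    sums and the rest telescopes.\<close>
  define v where "v n = real (Suc n) powr - \<epsilon>" for n
  define w where "w n = (v n)\<^sup>2" for n
  define A where "A N s = (\<Sum>n<N. dirichlet_term b s n)" for N s
  have v_pos: "0 < v n" for n by (simp add: v_def)
  have v_mono: "v (Suc n) \<le> v n" for n unfolding v_def using \<epsilon> by (intro powr_mono2') auto
  have v_lim: "v \<longlonglongrightarrow> 0" unfolding v_def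
    using \<epsilon> by real_asymp
  have A_le: "cmod (A (Suc n) s) * v n \<le> C" if "s \<in> S" for n s
  proof -
    have "cmod (A (Suc n) s) * v n \<le> C * real (Suc n) powr \<epsilon> * v n"
      unfolding A_def using bound[OF that] v_pos[of n] by (intro mult_right_mono) (auto simp del: sum.lessThan_Suc of_nat_Suc)
    thus ?thesis by (simp add: v_def powr_minus field_simps del: of_nat_Suc)
  qed
  \<comment> \<open>The weight \<open>w n\<close> is (n+1) to the power
    \<open>- 2 * \<epsilon>\<close>, so weighting the terms amounts to translating the series by
    \<open>2 * \<epsilon>\<close>.\<close>
  have w_shift: "dirichlet_term b (s + of_real (2 * \<epsilon>)) n = dirichlet_term b s n * of_real (w n)" for s n
  proof -
    have "complex_of_real (w n) = of_nat (Suc n) powr (- of_real (2 * \<epsilon>))"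
      by (simp add: w_def v_def powr_of_real[symmetric] power2_eq_square powr_add[symmetric] del: of_nat_Suc)
    thus ?thesis by (simp add: dirichlet_term_def powr_add[symmetric] algebra_simps del: of_nat_Suc)
  qed
  have abel: "(\<Sum>n<N. dirichlet_term b (s + of_real (2 * \<epsilon>)) n)
    = A N s * of_real (w N) + (\<Sum>n<N. A (Suc n) s * of_real (w n - w (Suc n)))" for N s
    unfolding w_shift A_def by (subst abel_summation) simp
  have boundary: "uniform_limit S (\<lambda>N s. A N s * of_real (w N)) (\<lambda>_. 0) sequentially"
  proof (rule uniform_limitI)
    fix e :: real assume "0 < e"
    moreover have "(\<lambda>n. \<bar>C\<bar> * v n) \<longlonglongrightarrow> 0" using tendsto_mult_right_zero[OF v_lim] by simp
    ultimately have "\<forall>\<^sub>F n in sequentially. \<bar>C\<bar> * v n < e" by (intro order_tendstoD(2)) auto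
    thus "\<forall>\<^sub>F N in sequentially. \<forall>s\<in>S. dist (A N s * of_real (w N)) 0 < e"
      using eventually_gt_at_top[of 0]
    proof eventually_elim
      case (elim N)
      show ?case
      proof
        fix s assume s: "s \<in> S"
        obtain n where n: "N = Suc n" using elim by (cases N) auto
        have "cmod (A N s) * w N = cmod (A N s) * v N * v N" by (simp add: w_def power2_eq_square)
        \<comment> \<open>\<open>A_le\<close> pairs the partial sum of length n+1 with
          \<open>v n\<close>, so one of the two factors \<open>v N\<close> is replaced by the larger
          \<open>v n\<close>; the other still tends to 0.\<close>
        also have "\<dots> \<le> cmod (A N s) * v n * v N"
          using v_mono[of n] v_pos[of N] by (intro mult_right_mono mult_left_mono) (auto simp: n)
        also have "\<dots> \<le> \<bar>C\<bar> * v N"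
          using A_le[OF s, of n] v_pos[of N] by (intro mult_right_mono) (auto simp: n)
        also have "\<dots> < e" using elim by simp
        finally show "dist (A N s * of_real (w N)) 0 < e" by (simp add: norm_mult norm_power w_def)
      qed
    qed
  qed
  have series: "uniform_limit S (\<lambda>N s. \<Sum>n<N. A (Suc n) s * of_real (w n - w (Suc n)))
    (\<lambda>s. \<Sum>n. A (Suc n) s * of_real (w n - w (Suc n))) sequentially"
  proof (rule Weierstrass_m_test)
    show "summable (\<lambda>n. 2 * \<bar>C\<bar> * (v n - v (Suc n)))"
      by (intro summable_mult telescope_summable'[OF v_lim])
    fix n s assume s: "s \<in> S"
    have "w n - w (Suc n) = (v n + v (Suc n)) * (v n - v (Suc n))"
      by (simp add: w_def power2_eq_square algebra_simps)
    also have "\<dots> \<le> (2 * v n) * (v n - v (Suc n))"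
      using v_mono[of n] by (intro mult_right_mono) auto
    finally have w_le: "w n - w (Suc n) \<le> (2 * v n) * (v n - v (Suc n))" .
    have "0 \<le> w n - w (Suc n)"
      unfolding w_def using v_mono[of n] v_pos[of "Suc n"] by (simp add: power_mono)
    hence "cmod (A (Suc n) s * of_real (w n - w (Suc n))) = cmod (A (Suc n) s) * (w n - w (Suc n))"
      by (simp only: norm_mult norm_of_real abs_of_nonneg)
    also have "\<dots> \<le> cmod (A (Suc n) s) * ((2 * v n) * (v n - v (Suc n)))"
      using w_le by (intro mult_left_mono) auto
    also have "\<dots> = 2 * (cmod (A (Suc n) s) * v n) * (v n - v (Suc n))" by simp
    also have "\<dots> \<le> 2 * \<bar>C\<bar> * (v n - v (Suc n))"
      using A_le[OF s, of n] v_mono[of n] by (intro mult_right_mono) auto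
    finally show "norm (A (Suc n) s * of_real (w n - w (Suc n))) \<le> 2 * \<bar>C\<bar> * (v n - v (Suc n))" .
  qed
  show ?thesis
    unfolding abel
  proof (rule exI)
    show "uniform_limit S (\<lambda>N s. A N s * of_real (w N) + (\<Sum>n<N. A (Suc n) s * of_real (w n - w (Suc n))))
      (\<lambda>s. 0 + (\<Sum>n. A (Suc n) s * of_real (w n - w (Suc n)))) sequentially"
      by (rule uniform_limit_add[OF boundary series])
  qed
qed

text \<open>Bohr's theorem. The growth bound for the partial sums gives uniform convergence after a
  small translation; the limit is holomorphic and agrees with \<open>f\<close> far to the right,
  hence wherever it is defined.\<close>

theorem dirichlet_sums_of_bounded_continuation:
  assumes hol: "f holomorphic_on halfplane 0"
    and bdd: "\<And>\<sigma>. 0 < \<sigma> \<Longrightarrow> \<exists>M. \<forall>s\<in>halfplane \<sigma>. cmod (f s) \<le> M"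
    and abs_sum: "summable (\<lambda>n. cmod (dirichlet_term b (of_real \<tau>) n))"
    and sums: "\<And>s. \<tau> \<le> Re s \<Longrightarrow> dirichlet_term b s sums f s"
    and z: "0 < Re z"
  shows "dirichlet_term b z sums f z"
proof -
  \<comment> \<open>The translation by \<open>2 * \<epsilon>\<close> costs at most half of
    \<open>Re z\<close>, so the translated point keeps real part at least \<open>Re z / 2\<close>,
    beyond \<open>\<sigma>\<close>. The minimum with 1 meets the range of \<open>\<epsilon>\<close>
    in the partial sum bound.\<close>
  define \<epsilon> where "\<epsilon> = min 1 (Re z / 4)"
  define \<sigma> where "\<sigma> = Re z / 4"
  have \<epsilon>: "0 < \<epsilon>" "\<epsilon> \<le> 1" and \<sigma>: "0 < \<sigma>" using z by (auto simp: \<epsilon>_def \<sigma>_def)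
  obtain C where C: "\<And>s N. s \<in> halfplane \<sigma> \<Longrightarrow> 0 < N \<Longrightarrow> cmod (\<Sum>n<N. dirichlet_term b s n) \<le> C * real N powr \<epsilon>"
    using dirichlet_partial_sum_bound[OF hol bdd abs_sum sums \<epsilon> \<sigma>] by blast
  obtain g where g: "uniform_limit (halfplane \<sigma>) (\<lambda>N s. \<Sum>n<N. dirichlet_term b (s + of_real (2 * \<epsilon>)) n) g sequentially"
    using dirichlet_uniform_limit_of_partial_sum_bound[OF \<epsilon>(1) C, of "halfplane \<sigma>"] by blast
  have g_sums: "dirichlet_term b (s + of_real (2 * \<epsilon>)) sums g s" if "s \<in> halfplane \<sigma>" for s
    using tendsto_uniform_limitI[OF g that] by (simp add: sums_def)
  have g_hol: "g holomorphic_on halfplane \<sigma>"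
  proof (rule holomorphic_uniform_sequence[OF open_halfplane])
    show "(\<lambda>s. \<Sum>n<N. dirichlet_term b (s + of_real (2 * \<epsilon>)) n) holomorphic_on halfplane \<sigma>" for N
      unfolding dirichlet_term_def by (intro holomorphic_intros)
    fix x assume "x \<in> halfplane \<sigma>"
    then obtain d where "0 < d" "cball x d \<subseteq> halfplane \<sigma>"
      using open_halfplane open_contains_cball by blast
    thus "\<exists>d>0. cball x d \<subseteq> halfplane \<sigma> \<and> uniform_limit (cball x d)
        (\<lambda>N s. \<Sum>n<N. dirichlet_term b (s + of_real (2 * \<epsilon>)) n) g sequentially"
      using uniform_limit_on_subset[OF g] by blast
  qed
  define s where "s = z - of_real (2 * \<epsilon>)"
  have s: "s \<in> halfplane \<sigma>" using z by (auto simp: s_def halfplane_def \<sigma>_def \<epsilon>_def)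
  have "g s = f (s + of_real (2 * \<epsilon>))"
  proof (rule halfplane_analytic_continuation[OF g_hol _ s])
    show "(\<lambda>s. f (s + of_real (2 * \<epsilon>))) holomorphic_on halfplane \<sigma>"
      using \<epsilon> \<sigma> by (intro holomorphic_on_compose_gen[OF _ hol, unfolded o_def] holomorphic_intros)
        (auto simp: halfplane_def)
    show "g z = f (z + of_real (2 * \<epsilon>))" if "max \<tau> \<sigma> < Re z" for z
      using g_sums[of z] sums[of "z + of_real (2 * \<epsilon>)"] that \<epsilon>
      by (intro sums_unique2) (auto simp: halfplane_def)
  qed
  with g_sums[OF s] show ?thesis by (simp add: s_def)
qed

section \<open>Superposition operators\<close>

text \<open>Dividing the coefficients by the power \<open>\<sigma>\<close> of n translates the
  series by \<open>\<sigma>\<close>. The half-planes of positive abscissa exhaust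
  \<open>halfplane 0\<close>, so the local properties, convergence and holomorphy, pass to the
  union, while boundedness remains a statement about each of them.\<close>

lemma H_infty_plus_iff:
  "a \<in> H_infty_plus \<longleftrightarrow> (\<forall>s\<in>halfplane 0. summable (dirichlet_term a s))
     \<and> dirichlet_sum a holomorphic_on halfplane 0
     \<and> (\<forall>\<sigma>>0. bounded (dirichlet_sum a ` halfplane \<sigma>))" (is "_ \<longleftrightarrow> ?conv \<and> ?hol \<and> ?bdd")
proof -
  define a' where "a' \<sigma> n = a n / of_real (real n powr \<sigma>)" for \<sigma> n
  have a'_mem: "a \<in> H_infty_plus \<longleftrightarrow> (\<forall>\<sigma>>0. a' \<sigma> \<in> H_infty)"
    unfolding H_infty_plus_def a'_def by simp
  have term_shift: "dirichlet_term (a' \<sigma>) s = dirichlet_term a (s + of_real \<sigma>)" for \<sigma> s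
    unfolding a'_def using dirichlet_term_shift by (intro ext)
  have sum_shift: "dirichlet_sum (a' \<sigma>) s = dirichlet_sum a (s + of_real \<sigma>)" for \<sigma> s
    unfolding dirichlet_sum_def term_shift ..
  have sum_image: "dirichlet_sum (a' \<sigma>) ` halfplane 0 = dirichlet_sum a ` halfplane \<sigma>" for \<sigma>
  proof -
    have "halfplane \<sigma> = (\<lambda>s. s + of_real \<sigma>) ` halfplane 0"
    proof (intro equalityI subsetI)
      fix s assume "s \<in> halfplane \<sigma>"
      thus "s \<in> (\<lambda>s. s + of_real \<sigma>) ` halfplane 0"
        by (intro image_eqI[where x = "s - of_real \<sigma>"]) (auto simp: halfplane_def)
    qed (auto simp: halfplane_def)
    thus ?thesis by (simp add: image_image sum_shift)
  qed
  show ?thesis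
  proof
    assume "a \<in> H_infty_plus"
    hence mem: "a' \<sigma> \<in> H_infty" if "0 < \<sigma>" for \<sigma> using that a'_mem by blast
    have ?conv
    proof
      fix s assume s: "s \<in> halfplane 0"
      have "summable (dirichlet_term (a' (Re s / 2)) (s - of_real (Re s / 2)))"
        using mem[of "Re s / 2"] s unfolding H_infty_def by (auto simp: halfplane_def)
      thus "summable (dirichlet_term a s)" by (simp add: term_shift)
    qed
    moreover have ?hol
    proof -
      have "dirichlet_sum a holomorphic_on halfplane \<sigma>" if "0 < \<sigma>" for \<sigma>
      proof -
        have "dirichlet_sum (a' \<sigma>) holomorphic_on halfplane 0" using mem[OF that] by (simp add: H_infty_def)
        hence "dirichlet_sum (a' \<sigma>) \<circ> (\<lambda>s. s - of_real \<sigma>) holomorphic_on halfplane \<sigma>"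
          by (rule holomorphic_on_compose_gen[rotated]) (auto simp: halfplane_def intro!: holomorphic_intros)
        thus ?thesis by (simp add: sum_shift o_def)
      qed
      hence "dirichlet_sum a holomorphic_on (\<Union>\<sigma>\<in>{0<..}. halfplane \<sigma>)"
        by (intro holomorphic_on_UN_open open_halfplane) auto
      moreover have "(\<Union>\<sigma>\<in>{0<..}. halfplane \<sigma>) = halfplane 0"
      proof (intro equalityI subsetI)
        fix s assume "s \<in> halfplane 0"
        thus "s \<in> (\<Union>\<sigma>\<in>{0<..}. halfplane \<sigma>)"
          by (intro UN_I[of "Re s / 2"]) (auto simp: halfplane_def)
      qed (auto simp: halfplane_def)
      ultimately show ?thesis by simp
    qed
    moreover have ?bdd
      using mem by (auto simp: H_infty_def sum_image)
    ultimately show "?conv \<and> ?hol \<and> ?bdd" by blast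
  next
    assume *: "?conv \<and> ?hol \<and> ?bdd"
    have "a' \<sigma> \<in> H_infty" if \<sigma>: "0 < \<sigma>" for \<sigma>
    proof -
      have "dirichlet_sum a holomorphic_on halfplane 0" using * by blast
      hence "dirichlet_sum a \<circ> (\<lambda>s. s + of_real \<sigma>) holomorphic_on halfplane 0"
        by (rule holomorphic_on_compose_gen[rotated]) (use \<sigma> in \<open>auto simp: halfplane_def intro!: holomorphic_intros\<close>)
      moreover have "dirichlet_sum a \<circ> (\<lambda>s. s + of_real \<sigma>) = dirichlet_sum (a' \<sigma>)"
        by (simp add: fun_eq_iff sum_shift)
      ultimately have "dirichlet_sum (a' \<sigma>) holomorphic_on halfplane 0" by simp
      moreover have "summable (dirichlet_term a (s + of_real \<sigma>))" if "s \<in> halfplane 0" for s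
        using * \<sigma> that by (auto simp: halfplane_def)
      ultimately show ?thesis
        using * \<sigma> by (simp add: H_infty_def term_shift sum_image)
    qed
    thus "a \<in> H_infty_plus" by (simp add: a'_mem)
  qed
qed

text \<open>The terms of a convergent series are bounded, and moving two units to the right
  multiplies their norms by the summable weight (n+1)^(-2).\<close>

lemma abs_dirichlet_of_summable:
  assumes "summable (dirichlet_term a s)"
  shows "\<exists>C. abs_dirichlet (Re s + 2) C (dirichlet_sum a)"
proof -
  have "Bseq (dirichlet_term a s)"
    using summable_LIMSEQ_zero[OF assms] by (intro convergent_imp_Bseq convergentI)
  then obtain B where B: "\<And>n. cmod (dirichlet_term a s n) \<le> B" by (auto simp: Bseq_def)
  have abs: "summable (\<lambda>n. cmod (dirichlet_term a z n))" if z: "Re s + 2 \<le> Re z" for z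
  proof (rule summable_comparison_test')
    have "summable (\<lambda>n. real (Suc n) powr - 2)"
      by (subst summable_Suc_iff) (simp add: summable_real_powr_iff)
    thus "summable (\<lambda>n. B * real (Suc n) powr - 2)" by (rule summable_mult)
    fix n
    have "cmod (dirichlet_term a z n) \<le> cmod (dirichlet_term a (s + 2) n)"
      using z by (intro norm_dirichlet_term_mono) simp
    also have "\<dots> = cmod (dirichlet_term a s n) * real (Suc n) powr - 2"
      unfolding norm_dirichlet_term by (simp add: powr_add[symmetric] del: of_nat_Suc)
    also have "\<dots> \<le> B * real (Suc n) powr - 2"
      by (intro mult_right_mono B) auto
    finally show "norm (cmod (dirichlet_term a z n)) \<le> B * real (Suc n) powr - 2" by simp
  qed
  have "(dirichlet_term a z has_sum dirichlet_sum a z) UNIV" if "Re s + 2 \<le> Re z" for z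
    unfolding dirichlet_sum_def using abs[OF that]
    by (auto intro: norm_summable_imp_has_sum[OF _ summable_sums] summable_norm_cancel)
  moreover have "((\<lambda>n. cmod (dirichlet_term a (of_real (Re s + 2)) n)) has_sum
      (\<Sum>n. cmod (dirichlet_term a (of_real (Re s + 2)) n))) UNIV"
    by (rule norm_summable_imp_has_sum[OF _ summable_sums]) (use abs[of "of_real (Re s + 2)"] in auto)
  ultimately show ?thesis unfolding abs_dirichlet_def by blast
qed

lemma superposition_well_defined_of_entire:
  assumes \<phi>: "\<phi> holomorphic_on UNIV"
  shows "superposition_well_defined \<phi> H_infty_plus (halfplane 0)"
  unfolding superposition_well_defined_def
proof
  fix a assume "a \<in> H_infty_plus"
  hence conv: "\<And>s. s \<in> halfplane 0 \<Longrightarrow> summable (dirichlet_term a s)"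
    and hol: "dirichlet_sum a holomorphic_on halfplane 0"
    and bdd: "\<And>\<sigma>. 0 < \<sigma> \<Longrightarrow> bounded (dirichlet_sum a ` halfplane \<sigma>)"
    unfolding H_infty_plus_iff by blast+
  define f where "f s = \<phi> (dirichlet_sum a s)" for s
  have f_hol: "f holomorphic_on halfplane 0"
    unfolding f_def by (intro holomorphic_on_compose_gen[OF hol \<phi>, unfolded o_def]) auto
  have f_bdd: "bounded (f ` halfplane \<sigma>)" if "0 < \<sigma>" for \<sigma>
  proof -
    \<comment> \<open>An entire function maps bounded sets to bounded sets: the closure is compact
      and \<open>\<phi>\<close> is continuous.\<close>
    have "compact (\<phi> ` closure (dirichlet_sum a ` halfplane \<sigma>))"
      using bdd[OF that] holomorphic_on_imp_continuous_on[OF \<phi>]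
      by (intro compact_continuous_image) (auto intro: continuous_on_subset simp: compact_closure)
    moreover have "f ` halfplane \<sigma> \<subseteq> \<phi> ` closure (dirichlet_sum a ` halfplane \<sigma>)"
      using closure_subset[of "dirichlet_sum a ` halfplane \<sigma>"] by (auto simp: f_def)
    ultimately show ?thesis using bounded_subset compact_imp_bounded by blast
  qed
  \<comment> \<open>Convergence at s = 1 yields absolute convergence from abscissa 3 on.\<close>
  obtain C where "abs_dirichlet (Re 1 + 2) C (dirichlet_sum a)"
    using abs_dirichlet_of_summable[OF conv[of 1]] by (auto simp: halfplane_def)
  then obtain C' where "abs_dirichlet (Re 1 + 2) C' f"
    unfolding f_def using abs_dirichlet_entire_comp \<phi> by blast
  then obtain b c where b: "((\<lambda>n. cmod (dirichlet_term b (of_real 3) n)) has_sum c) UNIV"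
    "\<And>s. 3 \<le> Re s \<Longrightarrow> (dirichlet_term b s has_sum f s) UNIV"
    by (auto simp: abs_dirichlet_def)
  have b_sums: "dirichlet_term b s sums f s" if "s \<in> halfplane 0" for s
  proof (rule dirichlet_sums_of_bounded_continuation[OF f_hol])
    show "\<exists>M. \<forall>s\<in>halfplane \<sigma>. cmod (f s) \<le> M" if "0 < \<sigma>" for \<sigma>
      using f_bdd[OF that] by (auto simp: bounded_iff)
    show "summable (\<lambda>n. cmod (dirichlet_term b (of_real 3) n))"
      using sums_summable[OF has_sum_imp_sums[OF b(1)]] .
  qed (use that b(2) has_sum_imp_sums in \<open>auto simp: halfplane_def\<close>)
  have b_sum: "dirichlet_sum b s = f s" if "s \<in> halfplane 0" for s
    unfolding dirichlet_sum_def using sums_unique[OF b_sums[OF that]] ..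
  have "b \<in> H_infty_plus" unfolding H_infty_plus_iff
  proof (intro conjI ballI allI impI)
    show "summable (dirichlet_term b s)" if "s \<in> halfplane 0" for s
      using b_sums[OF that] by (rule sums_summable)
    show "dirichlet_sum b holomorphic_on halfplane 0"
      using f_hol by (simp add: b_sum cong: holomorphic_cong)
    fix \<sigma> :: real assume "0 < \<sigma>"
    hence "dirichlet_sum b ` halfplane \<sigma> = f ` halfplane \<sigma>"
      by (intro image_cong b_sum) (auto simp: halfplane_def)
    thus "bounded (dirichlet_sum b ` halfplane \<sigma>)" using f_bdd[OF \<open>0 < \<sigma>\<close>] by simp
  qed
  thus "\<exists>b\<in>H_infty_plus. \<forall>s\<in>halfplane 0. dirichlet_term b s sums superposition \<phi> (dirichlet_sum a) s"
    using b_sums by (auto simp: superposition_def f_def)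
qed

text \<open>A Cauchy-Schwarz argument in termwise form: each term is split as \<open>x * y\<close>
  and bounded by the sum of the squares, which gives a majorant uniform on a ball for the
  Weierstrass test.\<close>

lemma H_plus_holomorphic:
  assumes b: "b \<in> H_plus"
  shows "dirichlet_sum b holomorphic_on halfplane (1/2)"
proof (rule holomorphic_uniform_sequence[OF open_halfplane])
  show "(\<lambda>s. \<Sum>n<N. dirichlet_term b s n) holomorphic_on halfplane (1/2)" for N
    unfolding dirichlet_term_def by (intro holomorphic_intros)
  fix z assume z: "z \<in> halfplane (1/2)"
  define d where "d = (Re z - 1/2) / 2"
  have d: "0 < d" using z by (simp add: d_def halfplane_def)
  have Re: "1/2 + d \<le> Re s" if "s \<in> cball z d" for s
    using that abs_Re_le_cmod[of "z - s"] by (simp add: d_def dist_norm field_simps)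
  have "uniform_limit (cball z d) (\<lambda>N s. \<Sum>n<N. dirichlet_term b s n) (\<lambda>s. \<Sum>n. dirichlet_term b s n) sequentially"
  proof (rule Weierstrass_m_test)
    have "summable (\<lambda>n. real (Suc n) powr (- 1 - d))"
      using d by (subst summable_Suc_iff) (simp add: summable_real_powr_iff)
    moreover have "summable (\<lambda>n. (cmod (b (Suc n)))\<^sup>2 * real (Suc n) powr (- 2 * (d / 2)))"
      by (rule b[unfolded H_plus_def mem_Collect_eq, rule_format]) (use d in simp)
    ultimately show "summable (\<lambda>n. (cmod (b (Suc n)))\<^sup>2 * real (Suc n) powr (- 2 * (d / 2)) + real (Suc n) powr (- 1 - d))"
      by (intro summable_add)
    fix n s assume s: "s \<in> cball z d"
    \<comment> \<open>The exponent 1/2 + d is split as d/2 + (1+d)/2. The squares of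
      \<open>x\<close> are summable by membership in \<open>H_plus\<close> with parameter
      \<open>d/2\<close>, those of \<open>y\<close> because 1 + d exceeds 1.\<close>
    define x where "x = cmod (b (Suc n)) * real (Suc n) powr (- d / 2)"
    define y where "y = real (Suc n) powr (- (1 + d) / 2)"
    have sq: "(real (Suc n) powr r)\<^sup>2 = real (Suc n) powr (2 * r)" for r
      by (simp add: power2_eq_square powr_add[symmetric] del: of_nat_Suc)
    have "cmod (dirichlet_term b s n) \<le> cmod (dirichlet_term b (of_real (1/2 + d)) n)"
      using Re[OF s] by (intro norm_dirichlet_term_mono) simp
    also have "\<dots> = x * y"
    proof -
      have "- Re (of_real (1/2 + d)) = - d / 2 + - (1 + d) / 2" by (simp add: field_simps)
      thus ?thesis unfolding norm_dirichlet_term x_def y_def by (simp only: powr_add mult.assoc)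
    qed
    also have "\<dots> \<le> x\<^sup>2 + y\<^sup>2"
    proof -
      have "0 \<le> x * y" by (simp add: x_def y_def)
      thus ?thesis using sum_squares_bound[of x y] by linarith
    qed
    also have "\<dots> = (cmod (b (Suc n)))\<^sup>2 * real (Suc n) powr (- 2 * (d / 2)) + real (Suc n) powr (- 1 - d)"
    proof -
      have "2 * (- d / 2) = - 2 * (d / 2)" "2 * (- (1 + d) / 2) = - 1 - d" by simp_all
      thus ?thesis unfolding x_def y_def power_mult_distrib sq by (simp only:)
    qed
    finally show "norm (dirichlet_term b s n)
      \<le> (cmod (b (Suc n)))\<^sup>2 * real (Suc n) powr (- 2 * (d / 2)) + real (Suc n) powr (- 1 - d)" .
  qed
  moreover have "cball z d \<subseteq> halfplane (1/2)" using Re d by (force simp: halfplane_def)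
  ultimately show "\<exists>d>0. cball z d \<subseteq> halfplane (1/2) \<and>
      uniform_limit (cball z d) (\<lambda>N s. \<Sum>n<N. dirichlet_term b s n) (dirichlet_sum b) sequentially"
    using d unfolding dirichlet_sum_def by blast
qed

section \<open>Two-term test series and the necessity of being entire\<close>

definition two_term :: "complex \<Rightarrow> complex \<Rightarrow> dirichlet_series" where
  "two_term c d n = (if n = 1 then c else if n = 2 then d else 0)"

lemma two_term_sums: "dirichlet_term (two_term c d) s sums (c + d * 2 powr - s)"
proof -
  have "dirichlet_term (two_term c d) s sums (\<Sum>n\<in>{0, 1}. dirichlet_term (two_term c d) s n)"
    by (rule sums_finite) (auto simp: dirichlet_term_def two_term_def)
  thus ?thesis by (simp add: dirichlet_term_def two_term_def)
qed

lemma dirichlet_sum_two_term: "dirichlet_sum (two_term c d) s = c + d * 2 powr - s"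
  using two_term_sums by (simp add: dirichlet_sum_def sums_iff)

lemma two_term_in_H_plus: "two_term c d \<in> H_plus"
  unfolding H_plus_def
  by (intro CollectI allI impI summable_finite[of "{0, 1}"]) (auto simp: two_term_def)

lemma two_term_in_H_infty_plus: "two_term c d \<in> H_infty_plus"
  unfolding H_infty_plus_iff
proof (intro conjI ballI allI impI)
  show "summable (dirichlet_term (two_term c d) s)" for s
    using two_term_sums by (rule sums_summable)
  show "dirichlet_sum (two_term c d) holomorphic_on halfplane 0"
    unfolding dirichlet_sum_two_term[abs_def] by (intro holomorphic_intros) auto
  fix \<sigma> :: real assume "0 < \<sigma>"
  have "cmod (c + d * 2 powr - s) \<le> cmod c + cmod d" if "s \<in> halfplane \<sigma>" for s
  proof -
    have "cmod (2 powr - s) = 2 powr - Re s" using norm_nat_powr[of 1 "- s"] by simp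
    also have "\<dots> \<le> 2 powr 0" using that \<open>0 < \<sigma>\<close> by (intro powr_mono) (auto simp: halfplane_def)
    finally have "cmod d * cmod (2 powr - s) \<le> cmod d * 1" by (intro mult_left_mono) auto
    thus ?thesis using norm_triangle_ineq[of c "d * 2 powr - s"] by (simp add: norm_mult)
  qed
  thus "bounded (dirichlet_sum (two_term c d) ` halfplane \<sigma>)"
    by (auto simp: bounded_iff dirichlet_sum_two_term)
qed

text \<open>One argument covers both spaces: it only needs the two-term series and holomorphy on
  \<open>halfplane (1/2)\<close>, the smaller of the two domains.\<close>

lemma entire_of_superposition_well_defined:
  assumes wd: "superposition_well_defined \<phi> E \<Omega>"
    and "halfplane (1/2) \<subseteq> \<Omega>" and "\<And>c d. two_term c d \<in> E"
    and hol: "\<And>b. b \<in> E \<Longrightarrow> dirichlet_sum b holomorphic_on halfplane (1/2)"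
  shows "\<phi> holomorphic_on UNIV"
proof -
  have "\<phi> holomorphic_on ball z (1/4)" for z
  proof -
    have "\<exists>b\<in>E. \<forall>s\<in>\<Omega>. dirichlet_term b s sums superposition \<phi> (dirichlet_sum (two_term (z - 1) 2)) s"
      by (rule bspec[OF wd[unfolded superposition_well_defined_def] assms(3)])
    then obtain b where b: "b \<in> E" "\<And>s. s \<in> \<Omega> \<Longrightarrow>
        dirichlet_term b s sums superposition \<phi> (dirichlet_sum (two_term (z - 1) 2)) s"
      by blast
    have comp: "\<phi> (z - 1 + 2 * 2 powr - s) = dirichlet_sum b s" if "s \<in> halfplane (1/2)" for s
    proof -
      have "dirichlet_term b s sums \<phi> (z - 1 + 2 * 2 powr - s)"
        using b(2)[of s] that assms(2) by (auto simp: superposition_def dirichlet_sum_two_term)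
      thus ?thesis by (simp add: dirichlet_sum_def sums_iff)
    qed
    \<comment> \<open>Solving w = z - 1 + 2 * 2^(-s) for s gives 2^(-s) = \<open>u w\<close> and s =
      \<open>g w\<close>. The centre w = z corresponds to \<open>u z\<close> = 1/2 and s = 1, in the
      interior of the half-plane; on the ball, \<open>u\<close> stays in the right half-plane, away
      from the cut of \<open>Ln\<close>.\<close>
    define u where "u w = (w - z + 1) / 2" for w
    define g where "g w = - Ln (u w) / of_real (ln 2)" for w
    have u: "0 < Re (u w)" "cmod (u w) \<le> 5/8" if "w \<in> ball z (1/4)" for w
    proof -
      have "cmod (w - z) < 1/4" using that by (simp add: dist_norm norm_minus_commute)
      thus "0 < Re (u w)" "cmod (u w) \<le> 5/8"
        using abs_Re_le_cmod[of "w - z"] norm_triangle_ineq[of "w - z" 1] by (auto simp: u_def norm_divide)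
    qed
    have g_hol: "g holomorphic_on ball z (1/4)"
    proof -
      have "u w \<notin> \<real>\<^sub>\<le>\<^sub>0" if "w \<in> ball z (1/4)" for w
        using u(1)[OF that] by (auto simp: complex_nonpos_Reals_iff)
      moreover have "u holomorphic_on ball z (1/4)" unfolding u_def by (intro holomorphic_intros) auto
      ultimately show ?thesis unfolding g_def by (intro holomorphic_intros) auto
    qed
    have g_halfplane: "g w \<in> halfplane (1/2)" if "w \<in> ball z (1/4)" for w
    proof -
      have "u w \<noteq> 0" using u(1)[OF that] by auto
      \<comment> \<open>The real part of \<open>g w\<close> exceeds 1/2 exactly when
        \<open>cmod (u w)\<close> is less than the square root of 1/2. Radius 1/4 achieves this,
        since (1 + 1/4)/2 = 5/8 and 25/64 < 1/2.\<close>
      have "(cmod (u w))\<^sup>2 \<le> (5/8)\<^sup>2" using u(2)[OF that] by (intro power_mono) auto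
      also have "\<dots> < 1/2" by (simp add: power2_eq_square)
      finally have "(cmod (u w))\<^sup>2 < 1/2" .
      hence "ln ((cmod (u w))\<^sup>2) < ln (1/2)" using \<open>u w \<noteq> 0\<close> by (intro ln_strict_mono) auto
      also have "ln (1/2 :: real) = - ln 2" by (simp add: ln_div)
      also have "ln ((cmod (u w))\<^sup>2) = 2 * ln (cmod (u w))" using \<open>u w \<noteq> 0\<close> by (simp add: ln_realpow)
      finally have "ln 2 / 2 < - ln (cmod (u w))" by simp
      thus ?thesis using \<open>u w \<noteq> 0\<close> by (simp add: g_def halfplane_def field_simps)
    qed
    have inverse: "z - 1 + 2 * 2 powr - g w = w" if "w \<in> ball z (1/4)" for w
    proof -
      have "u w \<noteq> 0" using u(1)[OF that] by auto
      have "Ln 2 = of_real (ln 2)" using Ln_of_real[of 2] by simp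
      hence power: "2 powr - g w = u w" using \<open>u w \<noteq> 0\<close> by (simp add: powr_def g_def)
      show ?thesis unfolding power u_def by (simp add: field_simps)
    qed
    have "(\<lambda>w. dirichlet_sum b (g w)) holomorphic_on ball z (1/4)"
      using g_halfplane by (intro holomorphic_on_compose_gen[OF g_hol hol[OF b(1)], unfolded o_def]) auto
    moreover have "dirichlet_sum b (g w) = \<phi> w" if "w \<in> ball z (1/4)" for w
      using comp[OF g_halfplane[OF that]] inverse[OF that] by simp
    ultimately show ?thesis by (rule holomorphic_transform)
  qed
  hence "\<phi> holomorphic_on (\<Union>z. ball z (1/4))" by (intro holomorphic_on_UN_open) auto
  moreover have "(\<Union>z::complex. ball z (1/4)) = UNIV"
    using centre_in_ball[of _ "1/4"] by fastforce
  ultimately show ?thesis by simp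
qed

theorem proposition5p2:
  fixes \<phi> :: "complex \<Rightarrow> complex"
  shows "(superposition_well_defined \<phi> H_infty_plus (halfplane 0) \<longleftrightarrow> \<phi> holomorphic_on UNIV)
       \<and> (superposition_well_defined \<phi> H_plus (halfplane (1/2)) \<longrightarrow> \<phi> holomorphic_on UNIV)"
proof (intro conjI iffI impI)
  have "halfplane (1/2) \<subseteq> halfplane 0" by (auto simp: halfplane_def)
  moreover from this have "dirichlet_sum b holomorphic_on halfplane (1/2)" if "b \<in> H_infty_plus" for b
    using that holomorphic_on_subset unfolding H_infty_plus_iff by blast
  ultimately show "\<phi> holomorphic_on UNIV" if "superposition_well_defined \<phi> H_infty_plus (halfplane 0)"
    using that two_term_in_H_infty_plus by (intro entire_of_superposition_well_defined)
  show "superposition_well_defined \<phi> H_infty_plus (halfplane 0)" if "\<phi> holomorphic_on UNIV"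
    using that by (rule superposition_well_defined_of_entire)
  show "\<phi> holomorphic_on UNIV" if "superposition_well_defined \<phi> H_plus (halfplane (1/2))"
    using that two_term_in_H_plus H_plus_holomorphic
    by (intro entire_of_superposition_well_defined[OF _ subset_refl])
qed

end
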